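(* Let $\{X_n\}_{n=0}^\infty$ be a random walk in a stationary, ergodic "have your cookie and eat it" environment $\omega=\{\omega(x)\}_{x\in\mathbb{Z}}$ with $\omega(x)\in[\frac12,1)$ for all $x\in\mathbb{Z}$, and let $\mathcal{P}^S$ denote the law of the environment and $\mathcal{E}^S$ the corresponding expectation. If $\mathcal{E}^S\frac{\omega(0)}{1-\omega(0)}\le2$, then for $\mathcal{P}^S$-almost every $\omega$ the process in the environment $\omega$ is recurrent. If $\mathcal{E}^S\frac{\omega(0)}{1-\omega(0)}>2$, then for $\mathcal{P}^S$-almost every $\omega$ the process in the environment $\omega$ is transient.
   Context: Random walk in a "have your cookie and eat it" environment: given $\omega=\{\omega(x)\}_{x\in\mathbb{Z}}$ with $\omega(x)\in[\frac12,1)$, the process $\{X_n\}_{n\ge0}$ is the nearest-neighbor process on $\mathbb{Z}$ (each step is $\pm1$) such that, conditionally on $X_0,\dots,X_n$, the probability that $X_{n+1}=X_n+1$ equals $\omega(X_n)$ if the process has not previously jumped left from the site $X_n$ (i.e. there is no $k<n$ with $X_k=X_n$ and $X_{k+1}=X_n-1$), and equals $\frac12$ otherwise; with the complementary probability $X_{n+1}=X_n-1$. For a fixed environment $\omega$, $P^\omega_x$ denotes the (quenched) law of the process in the environment $\omega$ started from $X_0=x$ (with no cookie consumed at time $0$). The process in the environment $\omega$ is called recurrent if $P^\omega_y(X_n=x\ \text{i.o.})=1$ for all $x,y\in\mathbb{Z}$, and transient if $P^\omega_y(X_n=x\ \text{i.o.})=0$ for all $x,y\in\mathbb{Z}$.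 "Stationary, ergodic" means that the random sequence $\{\omega(x)\}_{x\in\mathbb{Z}}$ has a law $\mathcal{P}^S$ that is invariant and ergodic under the spatial shift on $\mathbb{Z}$. The expectation of the nonnegative variable $\frac{\omega(0)}{1-\omega(0)}$ may be $+\infty$, which counts as being $>2$. *)

theory Defs
  imports "HOL-Probability.Probability"
begin

section \<open>Stationary ergodic environments\<close>

definition env_space :: "(int \<Rightarrow> real) measure" where
  "env_space = (\<Pi>\<^sub>M x\<in>UNIV. borel)"

definition shift :: "(int \<Rightarrow> real) \<Rightarrow> (int \<Rightarrow> real)" where
  "shift \<omega> = (\<lambda>x. \<omega> (x + 1))"

text \<open>The law of a random environment is a probability measure on the product space. Since
  the shift is invertible, invariance under it is invariance under all integer translations.\<close>

definition stationary_law :: "(int \<Rightarrow> real) measure \<Rightarrow> bool" where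
  "stationary_law P \<longleftrightarrow> prob_space P \<and> sets P = sets env_space \<and> distr P env_space shift = P"

definition ergodic_law :: "(int \<Rightarrow> real) measure \<Rightarrow> bool" where
  "ergodic_law P \<longleftrightarrow>
     (\<forall>A\<in>sets P. shift -` A \<inter> space P = A \<longrightarrow> measure P A = 0 \<or> measure P A = 1)"


section \<open>The walk in a fixed environment\<close>

definition jumped_left :: "(nat \<Rightarrow> int) \<Rightarrow> nat \<Rightarrow> bool" where
  "jumped_left X n \<longleftrightarrow> (\<exists>k<n. X k = X n \<and> X (Suc k) = X n - 1)"

definition right_prob :: "(int \<Rightarrow> real) \<Rightarrow> (nat \<Rightarrow> int) \<Rightarrow> nat \<Rightarrow> real" where
  "right_prob \<omega> X n = (if jumped_left X n then 1 / 2 else \<omega> (X n))"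

text \<open>\<open>walk_kernel \<omega> y n X\<close> is the conditional distribution of the position at time \<open>n\<close> given
  the positions \<open>X 0, \<dots>, X (n - 1)\<close>, the only values of \<open>X\<close> it depends on.\<close>

definition walk_kernel :: "(int \<Rightarrow> real) \<Rightarrow> int \<Rightarrow> nat \<Rightarrow> (nat \<Rightarrow> int) \<Rightarrow> int measure" where
  "walk_kernel \<omega> y n X = measure_pmf (case n of
       0 \<Rightarrow> return_pmf y
     | Suc m \<Rightarrow> map_pmf (\<lambda>b. if b then X m + 1 else X m - 1) (bernoulli_pmf (right_prob \<omega> X m)))"

lemma walk_kernel_Ionescu_Tulcea: "Ionescu_Tulcea (walk_kernel \<omega> y) (\<lambda>_. count_space UNIV)"
proof (rule Ionescu_Tulcea.intro)
  fix n :: nat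
  have "walk_kernel \<omega> y n \<in>
      measurable (count_space (\<Pi>\<^sub>E i\<in>{0..<n}. UNIV)) (subprob_algebra (count_space UNIV))"
    by (auto simp: walk_kernel_def space_subprob_algebra
        intro!: prob_space_imp_subprob_space prob_space_measure_pmf)
  moreover have "sets (\<Pi>\<^sub>M i\<in>{0..<n}. count_space (UNIV :: int set))
      = sets (count_space (\<Pi>\<^sub>E i\<in>{0..<n}. UNIV))"
    by (subst count_space_PiM_finite) auto
  ultimately show "walk_kernel \<omega> y n \<in>
      measurable (\<Pi>\<^sub>M i\<in>{0..<n}. count_space UNIV) (subprob_algebra (count_space UNIV))"
    using measurable_cong_sets by blast
qed (simp add: walk_kernel_def prob_space_measure_pmf)

text \<open>The quenched law of the whole trajectory, given by the Ionescu-Tulcea theorem.\<close>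

definition walk_law :: "(int \<Rightarrow> real) \<Rightarrow> int \<Rightarrow> (nat \<Rightarrow> int) measure" where
  "walk_law \<omega> y = projective_family.lim UNIV
     (Ionescu_Tulcea.CI (walk_kernel \<omega> y) (\<lambda>_. count_space UNIV)) (\<lambda>_. count_space UNIV)"

context
  fixes \<omega> :: "int \<Rightarrow> real" and y :: int
begin

interpretation IT: Ionescu_Tulcea "walk_kernel \<omega> y" "\<lambda>_. count_space UNIV"
  by (rule walk_kernel_Ionescu_Tulcea)

lemma sets_walk_law: "sets (walk_law \<omega> y) = sets (\<Pi>\<^sub>M n\<in>UNIV. count_space UNIV)"
  by (simp add: walk_law_def)

lemma space_walk_law: "space (walk_law \<omega> y) = UNIV"
  by (simp add: walk_law_def space_PiM)

lemma prob_space_walk_law: "prob_space (walk_law \<omega> y)"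
proof
  have "emeasure IT.PF.lim (IT.PF.emb UNIV {} {\<lambda>_. undefined}) = emeasure (IT.CI {}) {\<lambda>_. undefined}"
    by (rule IT.lim) (auto simp: PiM_empty)
  also have "\<dots> = 1"
  proof -
    have "prob_space (IT.CI {})" by (rule IT.PF.prob_space_P) auto
    moreover have "space (IT.CI {}) = {\<lambda>_. undefined}"
      by (simp add: IT.CI_def space_PiM)
    ultimately show ?thesis by (metis prob_space.emeasure_space_1)
  qed
  also have "IT.PF.emb UNIV {} {\<lambda>_. undefined} = space IT.PF.lim"
    by (auto simp: prod_emb_def space_PiM)
  finally show "emeasure (walk_law \<omega> y) (space (walk_law \<omega> y)) = 1"
    by (simp add: walk_law_def)
qed

lemma emeasure_walk_law_cylinder:
  "emeasure (walk_law \<omega> y) {X. \<forall>k<n. X k = a k}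
     = emeasure (IT.C 0 n (\<lambda>_. undefined)) {restrict a {0..<n}}"
proof -
  have S: "{restrict a {0..<n}} \<in> sets (\<Pi>\<^sub>M i\<in>{0..<n}. count_space (UNIV :: int set))"
    by (subst count_space_PiM_finite) auto
  have "{X. \<forall>k<n. X k = a k} = IT.PF.emb UNIV {0..<n} {restrict a {0..<n}}"
    by (auto simp: prod_emb_def space_PiM restrict_def fun_eq_iff) (metis)
  moreover have "IT.PF.emb {0..<n} {0..<n} {restrict a {0..<n}} = {restrict a {0..<n}}"
    by (rule prod_emb_id) auto
  ultimately show ?thesis
    using IT.lim[OF _ S] IT.emeasure_CI[of "{0..<n}" n, OF _ S] by (simp add: walk_law_def)
qed

lemma walk_kernel_cong: "(\<And>k. k < n \<Longrightarrow> X k = Y k) \<Longrightarrow> walk_kernel \<omega> y n X = walk_kernel \<omega> y n Y"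
proof (cases n)
  case (Suc m)
  assume XY: "\<And>k. k < n \<Longrightarrow> X k = Y k"
  then have "X m = Y m" and "jumped_left X m = jumped_left Y m"
    by (auto simp: Suc jumped_left_def)
  then show ?thesis unfolding Suc walk_kernel_def right_prob_def nat.case by metis
qed (simp add: walk_kernel_def)

lemma emeasure_walk_law_step:
  "emeasure (walk_law \<omega> y) {X. \<forall>k<Suc n. X k = a k}
     = emeasure (walk_law \<omega> y) {X. \<forall>k<n. X k = a k} * emeasure (walk_kernel \<omega> y n a) {a n}"
proof -
  let ?C = "IT.C 0 n (\<lambda>_. undefined)"
  let ?a = "restrict a {0..<n}" and ?b = "restrict a {0..<Suc n}"
  have b: "{?b} \<in> sets (\<Pi>\<^sub>M i\<in>{0..<Suc n}. count_space (UNIV :: int set))"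
    by (subst count_space_PiM_finite) auto
  have sp: "space ?C = (\<Pi>\<^sub>E i\<in>{0..<n}. UNIV)"
    by (subst IT.space_C) (auto simp: space_PiM)
  have sC: "sets ?C = sets (\<Pi>\<^sub>M i\<in>{0..<n}. count_space UNIV)"
    by (subst IT.sets_C) auto
  have a: "{?a} \<in> sets ?C"
    unfolding sC by (subst count_space_PiM_finite) auto
  have m: "IT.eP n \<in> measurable ?C (subprob_algebra (\<Pi>\<^sub>M i\<in>{0..<Suc n}. count_space UNIV))"
    using IT.measurable_eP[of n] measurable_cong_sets[OF sC refl] by blast
  have "emeasure (IT.C 0 (Suc n) (\<lambda>_. undefined)) {?b} = (\<integral>\<^sup>+h. emeasure (IT.eP n h) {?b} \<partial>?C)"
    using m b sp by (simp, subst emeasure_bind[OF _ m b]) (auto simp: PiE_eq_empty_iff)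
  also have "\<dots> = (\<integral>\<^sup>+h. emeasure (walk_kernel \<omega> y n a) {a n} * indicator {?a} h \<partial>?C)"
  proof (rule nn_integral_cong)
    fix h assume "h \<in> space ?C"
    then have h: "h \<in> space (\<Pi>\<^sub>M i\<in>{0..<n}. count_space (UNIV :: int set))"
      and hx: "h \<in> extensional {0..<n}"
      by (simp_all add: sp space_PiM PiE_def)
    have "(\<lambda>x. h(n := x)) -` {?b} = (if h = ?a then {a n} else {})"
    proof (cases "h = ?a")
      case True
      moreover have "?a(n := x) = ?b \<longleftrightarrow> x = a n" for x
      proof
        assume "?a(n := x) = ?b"
        from fun_cong[OF this, of n] show "x = a n" by simp
      qed (auto simp: fun_eq_iff)
      ultimately show ?thesis by auto
    next
      case False
      have "h = ?a" if "h(n := x) = ?b" for x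
      proof (rule extensionalityI[OF hx])
        fix i assume "i \<in> {0..<n}"
        with fun_cong[OF that, of i] show "h i = ?a i" by auto
      qed auto
      with False show ?thesis by auto
    qed
    moreover have "walk_kernel \<omega> y n ?a = walk_kernel \<omega> y n a"
      by (rule walk_kernel_cong) auto
    ultimately show "emeasure (IT.eP n h) {?b}
        = emeasure (walk_kernel \<omega> y n a) {a n} * indicator {?a} h"
      by (simp add: IT.emeasure_eP[OF h b])
  qed
  also have "\<dots> = emeasure (walk_kernel \<omega> y n a) {a n} * emeasure ?C {?a}"
    using a by (simp add: nn_integral_cmult_indicator)
  finally show ?thesis
    by (simp add: emeasure_walk_law_cylinder mult.commute del: IT.C.simps)
qed

end

text \<open>The defining properties of the quenched law: start at \<open>y\<close>, and the given one-step
  conditional probabilities.\<close>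

lemma walk_law_start: "measure (walk_law \<omega> y) {X. X 0 = y} = 1"
proof -
  have "emeasure (walk_law \<omega> y) {X. X 0 = y} = 1"
    using emeasure_walk_law_step[of \<omega> y 0 "\<lambda>_. y"]
      prob_space.emeasure_space_1[OF prob_space_walk_law, of \<omega> y]
    by (simp add: space_walk_law walk_kernel_def)
  then show ?thesis by (simp add: measure_def)
qed

lemma walk_law_step:
  "measure (walk_law \<omega> y) {X. (\<forall>k\<le>n. X k = a k) \<and> X (Suc n) = z}
     = measure (walk_law \<omega> y) {X. \<forall>k\<le>n. X k = a k} *
       pmf (map_pmf (\<lambda>b. if b then a n + 1 else a n - 1) (bernoulli_pmf (right_prob \<omega> a n))) z"
proof -
  have e: "{X. (\<forall>k\<le>n. X k = a k) \<and> X (Suc n) = z}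
      = {X. \<forall>k<Suc (Suc n). X k = (a(Suc n := z)) k}"
    "{X. \<forall>k\<le>n. X k = a k} = {X. \<forall>k<Suc n. X k = (a(Suc n := z)) k}"
    by (auto simp: less_Suc_eq_le le_Suc_eq)
  have k: "walk_kernel \<omega> y (Suc n) (a(Suc n := z)) = walk_kernel \<omega> y (Suc n) a"
    by (rule walk_kernel_cong) auto
  show ?thesis
    unfolding e measure_def emeasure_walk_law_step[of \<omega> y "Suc n"] k
    by (simp add: enn2real_mult walk_kernel_def pmf.rep_eq measure_def)
qed

definition recurrent_env :: "(int \<Rightarrow> real) \<Rightarrow> bool" where
  "recurrent_env \<omega> \<longleftrightarrow> (\<forall>x y. measure (walk_law \<omega> y) {X. \<exists>\<^sub>\<infinity>n. X n = x} = 1)"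

definition transient_env :: "(int \<Rightarrow> real) \<Rightarrow> bool" where
  "transient_env \<omega> \<longleftrightarrow> (\<forall>x y. measure (walk_law \<omega> y) {X. \<exists>\<^sub>\<infinity>n. X n = x} = 0)"

text \<open>\<^const>\<open>measure\<close> is \<open>0\<close> on non-measurable sets; this event is measurable.\<close>

lemma sets_infinitely_often: "{X. \<exists>\<^sub>\<infinity>n. X n = x} \<in> sets (walk_law \<omega> y)"
proof -
  have [measurable]: "(\<lambda>X. X n) \<in> measurable (walk_law \<omega> y) (count_space UNIV)" for n
    unfolding measurable_cong_sets[OF sets_walk_law refl]
    by (rule measurable_component_singleton) simp
  have "{X \<in> space (walk_law \<omega> y). \<forall>m. \<exists>n\<ge>m. X n = x} \<in> sets (walk_law \<omega> y)"
    by measurable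
  then show ?thesis by (simp add: space_walk_law INFM_nat_le)
qed

end

(* Before the walk started at 0 first reaches n, the number of left jumps from x is,
   for x = n-1, ..., 0, a Markov chain: each value is the number of left jumps made at x
   before a prescribed number of right jumps.  The chain starts at 0 at site n and needs one right
   jump more at x than there are left jumps from x+1.  As n grows, the count at 0 increases in
   law, and it either tends to infinity (the recurrent case) or has a proper limit.

   If the chain has value u at x+1 and nu = w(x)/(1 - w(x)), its mean changes at x by
   2 - nu + w(x)^u nu (2 w(x) - 1), which is at least 2 - nu and tends to 2 - nu as u grows.
   Averaging over the stationary environment: in the recurrent case a mean of nu above 2 would
   drive the nonnegative expected count below 0.  In the transient case a mean of nu at most 2
   makes the expected count grow linearly in n, which contradicts tightness together with the
   quadratic bound on its second moment.  Ergodicity leaves only these two cases.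

   The walk itself is only analysed through its first step, after which it is a fresh walk in the
   same environment or, after a left jump from y, in the environment with w(y) replaced by 1/2. *)

theory Submission
  imports Defs
begin

section \<open>Left jumps at a single site\<close>

text \<open>The drift \<open>2 - nu\<close> arises as follows. Until its first left jump a fresh
  site makes \<open>nu\<close> right jumps on average. If \<open>u + 1\<close> right jumps are
  required and \<open>u\<close> is large, the cookie phase supplies \<open>nu\<close> of them and
  ends in one left jump; the other \<open>u + 1 - nu\<close> come from a fair coin and cost as many
  left jumps, which makes \<open>u + 2 - nu\<close> in all. The obstacle is that the walk is not
  Markov, and its splitting into independent jump sequences at the sites is hard to express for path
  measures. The chain is therefore only a recursion for distribution functions. It is tied to the
  walk because both obey the same first-step equations in the pair of environment and position, with
  a maximum principle on strips for uniqueness. As a left jump alters the environment, these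
  statements range over all environments. Two degeneracies shape the analysis: the limit law might
  lose mass at infinity, so the recursion is kept in a form valid for defective laws; and
  \<open>nu\<close> may have infinite mean, so the argument rests on drifts, which are bounded above
  by 1.\<close>

text \<open>At a fresh site with right probability \<open>p\<close>, \<open>left_cdf p t K\<close> is the probability of at
  most \<open>K\<close> left jumps before the \<open>t\<close>-th right jump. The first jump gives the recursion.\<close>

fun left_cdf :: "real \<Rightarrow> nat \<Rightarrow> nat \<Rightarrow> real" where
  "left_cdf p 0 K = 1"
| "left_cdf p (Suc t) 0 = p * left_cdf p t 0"
| "left_cdf p (Suc t) (Suc K) = p * left_cdf p t (Suc K) + (1 - p) * left_cdf (1 / 2) (Suc t) K"

text \<open>At most \<open>K\<close> left jumps precede the \<open>t\<close>-th right jump exactly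
  when at least \<open>t\<close> right jumps precede left jump number \<open>K + 1\<close>. So this
  is the probability that exactly \<open>t\<close> right jumps precede that left jump. It is a law
  in \<open>t\<close> for fixed \<open>K\<close>, while summing over \<open>K\<close> counts the
  left jumps between two successive right jumps.\<close>

definition left_dif :: "real \<Rightarrow> nat \<Rightarrow> nat \<Rightarrow> real" where
  "left_dif p t K = left_cdf p t K - left_cdf p (Suc t) K"

lemma left_cdf_bounds:
  assumes "0 \<le> p" "p \<le> 1"
  shows "0 \<le> left_cdf p t K \<and> left_cdf p t K \<le> 1"
  using assms
  by (induction p t K rule: left_cdf.induct) (auto intro!: mult_le_one convex_bound_le)

lemma left_dif_Suc_0: "left_dif p (Suc t) 0 = p * left_dif p t 0"
  by (simp add: left_dif_def right_diff_distrib)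

lemma left_dif_Suc_Suc:
  "left_dif p (Suc t) (Suc K) = p * left_dif p t (Suc K) + (1 - p) * left_dif (1 / 2) (Suc t) K"
  by (simp add: left_dif_def algebra_simps)

lemma left_dif_0: "left_dif p 0 0 = 1 - p"
  by (simp add: left_dif_def)

lemma left_dif_nonneg:
  assumes "0 \<le> p" "p \<le> 1"
  shows "0 \<le> left_dif p t K"
  using assms
proof (induction p t K rule: left_cdf.induct)
  case (1 p K)
  then show ?case using left_cdf_bounds[of p 1 K] by (simp add: left_dif_def)
qed (simp_all add: left_dif_Suc_0 left_dif_Suc_Suc)

lemma left_cdf_antimono: "0 \<le> p \<Longrightarrow> p \<le> 1 \<Longrightarrow> s \<le> t \<Longrightarrow> left_cdf p t K \<le> left_cdf p s K"
  by (rule lift_Suc_antimono_le) (use left_dif_nonneg left_dif_def in \<open>auto simp: left_dif_def\<close>)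

lemma left_cdf_Suc_mono: "0 \<le> p \<Longrightarrow> p \<le> 1 \<Longrightarrow> left_cdf p t K \<le> left_cdf p t (Suc K)"
proof (induction p t K rule: left_cdf.induct)
  case (2 p t)
  have "p * left_cdf p t 0 \<le> p * left_cdf p t (Suc 0)"
    using 2 by (intro mult_left_mono) auto
  moreover have "0 \<le> (1 - p) * left_cdf (1 / 2) (Suc t) 0"
    using 2 left_cdf_bounds[of "1/2" "Suc t" 0] by auto
  ultimately show ?case by (simp del: left_cdf.simps(2) add: left_cdf.simps(2)[of p])
next
  case (3 p t K)
  then show ?case 
    by (subst (1 2) left_cdf.simps(3)) (intro add_mono mult_left_mono, auto)
qed simp

lemma left_cdf_mono: "0 \<le> p \<Longrightarrow> p \<le> 1 \<Longrightarrow> K \<le> L \<Longrightarrow> left_cdf p t K \<le> left_cdf p t L"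
  by (rule lift_Suc_mono_le) (auto intro: left_cdf_Suc_mono)

text \<open>Antitonicity in \<open>t\<close> gives a limit \<open>l\<close>, and the recursion
  becomes \<open>l = p * l\<close> because the fair part vanishes by induction on
  \<open>K\<close>.\<close>

lemma left_cdf_tendsto_0:
  assumes "0 \<le> p" "p < 1"
  shows "(\<lambda>t. left_cdf p t K) \<longlonglongrightarrow> 0"
  using assms
proof (induction K arbitrary: p)
  case 0
  have "left_cdf p t 0 = p ^ t" for t by (induction t) auto
  with 0 show ?case by (simp add: LIMSEQ_realpow_zero)
next
  case (Suc K)
  have "decseq (\<lambda>t. left_cdf p t (Suc K))"
    using Suc.prems by (auto simp: decseq_def left_cdf_antimono)
  moreover have "0 \<le> left_cdf p t (Suc K)" for t
    using left_cdf_bounds[of p] Suc.prems by auto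
  ultimately obtain l where l: "(\<lambda>t. left_cdf p t (Suc K)) \<longlonglongrightarrow> l"
    using decseq_convergent[of _ 0] by metis
  have "(\<lambda>t. p * left_cdf p t (Suc K) + (1 - p) * left_cdf (1 / 2) (Suc t) K) \<longlonglongrightarrow> p * l + (1 - p) * 0"
    by (intro tendsto_intros l LIMSEQ_Suc Suc.IH) auto
  moreover have "(\<lambda>t. left_cdf p (Suc t) (Suc K)) \<longlonglongrightarrow> l"
    using l by (rule LIMSEQ_Suc)
  ultimately have "l = p * l + (1 - p) * 0"
    using LIMSEQ_unique unfolding left_cdf.simps by blast
  then have "l * (1 - p) = 0" by (simp add: algebra_simps)
  with Suc.prems have "l = 0" by auto
  with l show ?case by simp
qed

text \<open>The recursion passes to limits in \<open>K\<close>. The fair site is settled before the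
  general one, whose recursion refers to it.\<close>

lemma left_cdf_tendsto_1:
  assumes "0 \<le> p" "p < 1"
  shows "(\<lambda>K. left_cdf p t K) \<longlonglongrightarrow> 1"
proof -
  have lim: "\<exists>l. (\<lambda>K. left_cdf p t K) \<longlonglongrightarrow> l" if "0 \<le> p" "p < 1" for p t
  proof -
    have "incseq (\<lambda>K. left_cdf p t K)" using that by (auto simp: incseq_def left_cdf_mono)
    moreover have "left_cdf p t K \<le> 1" for K using left_cdf_bounds[of p] that by auto
    ultimately show ?thesis using incseq_convergent[of _ 1] by metis
  qed
  have step: "m = p * l + (1 - p) * l'"
    if "0 \<le> p" "p < 1" "(\<lambda>K. left_cdf p t K) \<longlonglongrightarrow> l" "(\<lambda>K. left_cdf p (Suc t) K) \<longlonglongrightarrow> m"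
      "(\<lambda>K. left_cdf (1 / 2) (Suc t) K) \<longlonglongrightarrow> l'" for p l l' m and t :: nat
  proof -
    have "(\<lambda>K. p * left_cdf p t (Suc K) + (1 - p) * left_cdf (1 / 2) (Suc t) K) \<longlonglongrightarrow> p * l + (1 - p) * l'"
      by (intro tendsto_intros LIMSEQ_Suc[OF that(3)] that)
    moreover have "(\<lambda>K. left_cdf p (Suc t) (Suc K)) \<longlonglongrightarrow> m"
      using that(4) by (rule LIMSEQ_Suc)
    ultimately show ?thesis using LIMSEQ_unique by auto
  qed
  have half: "(\<lambda>K. left_cdf (1 / 2) t K) \<longlonglongrightarrow> 1" for t
  proof (induction t)
    case (Suc t)
    obtain l where l: "(\<lambda>K. left_cdf (1 / 2) (Suc t) K) \<longlonglongrightarrow> l" using lim[of "1/2"] by auto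
    with step[OF _ _ Suc l l] show ?case by (simp add: field_simps)
  qed simp
  show ?thesis
  proof (induction t)
    case (Suc t)
    obtain l where l: "(\<lambda>K. left_cdf p (Suc t) K) \<longlonglongrightarrow> l" using lim[of p] assms by auto
    with step[OF assms Suc l half] show ?case by simp
  qed simp
qed

section \<open>The chain of left jumps along the sites\<close>

lemma left_dif_sums:
  assumes "0 \<le> p" "p < 1"
  shows "(\<lambda>t. left_dif p (t + i) K) sums left_cdf p i K"
  using telescope_sums'[OF LIMSEQ_ignore_initial_segment[OF left_cdf_tendsto_0[OF assms, of K], of i]]
  by (simp add: left_dif_def)

lemma summable_left_dif_mult:
  assumes "0 \<le> p" "p < 1" "\<And>t. 0 \<le> F t \<and> F t \<le> 1"
  shows "summable (\<lambda>t. left_dif p (t + i) K * F t)"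
proof (rule summable_comparison_test'[OF sums_summable[OF left_dif_sums[OF assms(1,2), of i K]]])
  fix t
  show "norm (left_dif p (t + i) K * F t) \<le> left_dif p (t + i) K"
    using left_dif_nonneg[of p "t + i" K] assms by (auto simp: abs_mult intro: mult_left_le)
qed

definition cookie_env :: "(int \<Rightarrow> real) \<Rightarrow> bool" where
  "cookie_env w \<longleftrightarrow> (\<forall>x. 1 / 2 \<le> w x \<and> w x < 1)"

lemma cookie_envD:
  assumes "cookie_env w"
  shows "1 / 2 \<le> w x" "w x < 1" "0 \<le> w x" "w x \<le> 1" "0 < w x"
  using assms[unfolded cookie_env_def, rule_format, of x] by auto

lemma cookie_env_shift [simp]: "cookie_env w \<Longrightarrow> cookie_env (shift w)"
  by (simp add: cookie_env_def shift_def)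

lemma cookie_env_upd [simp]: "cookie_env w \<Longrightarrow> cookie_env (w(y := 1 / 2))"
  by (simp add: cookie_env_def)

text \<open>\<open>exit_cdf n w y K\<close> is the probability of at most \<open>K\<close> left jumps from \<open>0\<close> before the walk
  from \<open>y\<close> reaches \<open>n\<close>; in terms of the chain, one extra right jump is needed exactly at the sites
  \<open>x \<ge> y\<close>. The sum over the value \<open>t\<close> of the chain at the next site is in Abel-summed form.\<close>

primrec exit_cdf :: "nat \<Rightarrow> (int \<Rightarrow> real) \<Rightarrow> int \<Rightarrow> nat \<Rightarrow> real" where
  "exit_cdf 0 = (\<lambda>w y K. 1)"
| "exit_cdf (Suc n) = (\<lambda>w y K.
     \<Sum>t. left_dif (w 0) (t + (if y \<le> 0 then 1 else 0)) K * exit_cdf n (shift w) (y - 1) t)"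

lemma exit_cdf_cong:
  "(\<And>x. 0 \<le> x \<Longrightarrow> w x = w' x) \<Longrightarrow> exit_cdf n w y = exit_cdf n w' y"
proof (induction n arbitrary: w w' y)
  case (Suc n)
  have "exit_cdf n (shift w) (y - 1) = exit_cdf n (shift w') (y - 1)"
    using Suc.prems by (intro Suc.IH) (simp add: shift_def)
  with Suc.prems[of 0] show ?case by simp
qed simp

lemma exit_cdf_nonpos: "y \<le> 0 \<Longrightarrow> exit_cdf n w y = exit_cdf n w 0"
proof (induction n arbitrary: w y)
  case (Suc n)
  have "exit_cdf n (shift w) (y - 1) = exit_cdf n (shift w) 0"
    "exit_cdf n (shift w) (0 - 1) = exit_cdf n (shift w) 0"
    using Suc.prems by (intro Suc.IH; simp)+
  with Suc.prems show ?case by simp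
qed simp

lemma exit_cdf_bounds:
  "cookie_env w \<Longrightarrow> 0 \<le> exit_cdf n w y K \<and> exit_cdf n w y K \<le> 1"
proof (induction n arbitrary: w y K)
  case (Suc n)
  let ?i = "if y \<le> 0 then 1 else 0 :: nat"
  note b = cookie_envD[OF Suc.prems, of 0]
  have F: "0 \<le> exit_cdf n (shift w) (y - 1) t \<and> exit_cdf n (shift w) (y - 1) t \<le> 1" for t
    using Suc by simp
  note S = summable_left_dif_mult[OF b(3) b(2) F]
  have "(\<Sum>t. left_dif (w 0) (t + ?i) K * exit_cdf n (shift w) (y - 1) t) \<le> (\<Sum>t. left_dif (w 0) (t + ?i) K)"
    using left_dif_nonneg[OF b(3,4)] F
    by (intro suminf_le S sums_summable[OF left_dif_sums[OF b(3,2)]]) (auto intro: mult_left_le)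
  also have "\<dots> = left_cdf (w 0) ?i K"
    using left_dif_sums[OF b(3,2)] by (rule sums_unique[symmetric])
  also have "\<dots> \<le> 1" using left_cdf_bounds b by auto
  finally show ?case using left_dif_nonneg[OF b(3,4)] F
    unfolding exit_cdf.simps by (intro conjI suminf_nonneg S mult_nonneg_nonneg) auto
qed simp

lemma exit_cdf_summable:
  "0 \<le> p \<Longrightarrow> p < 1 \<Longrightarrow> cookie_env w \<Longrightarrow> summable (\<lambda>t. left_dif p (t + i) K * exit_cdf n w y t)"
  using exit_cdf_bounds by (intro summable_left_dif_mult) auto

lemma exit_cdf_top: "cookie_env w \<Longrightarrow> exit_cdf n w (int n) K = 1"
proof (induction n arbitrary: w K)
  case (Suc n)
  have "(\<lambda>t. left_dif (w 0) (t + 0) K) sums left_cdf (w 0) 0 K"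
    using cookie_envD[OF Suc.prems, of 0] by (intro left_dif_sums) auto
  with Suc show ?case by (simp add: sums_iff)
qed simp

text \<open>Condition on the first step from \<open>y\<close>: after a step to the left the cookie at \<open>y\<close> is
  gone, and one left jump from \<open>y\<close> has been used up.\<close>

lemma exit_cdf_step_0:
  assumes "cookie_env w" "n > 0"
  shows "exit_cdf n w 0 K = w 0 * exit_cdf n w 1 K
    + (1 - w 0) * (case K of 0 \<Rightarrow> 0 | Suc L \<Rightarrow> exit_cdf n (w(0 := 1 / 2)) 0 L)"
proof -
  obtain m where n: "n = Suc m" using assms(2) by (cases n) auto
  let ?F = "\<lambda>t. exit_cdf m (shift w) 0 t"
  have neg: "exit_cdf m (shift w) (- 1) = exit_cdf m (shift w) 0"
    by (rule exit_cdf_nonpos) simp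
  have neg': "exit_cdf m (shift (w(0 := 1 / 2))) (- 1) = exit_cdf m (shift w) 0"
    by (subst exit_cdf_nonpos, simp) (rule exit_cdf_cong, simp add: shift_def)
  have S: "summable (\<lambda>t. left_dif (w 0) (t + 0) K * ?F t)"
    "summable (\<lambda>t. left_dif ((w(0 := 1 / 2)) 0) (t + 1) K * ?F t)" for K
    using assms cookie_envD[OF assms(1), of 0] by (intro exit_cdf_summable; simp)+
  show ?thesis
  proof (cases K)
    case 0
    have "(\<Sum>t. left_dif (w 0) (t + 1) 0 * ?F t) = (\<Sum>t. w 0 * (left_dif (w 0) (t + 0) 0 * ?F t))"
      by (simp add: left_dif_Suc_0 mult.assoc)
    also have "\<dots> = w 0 * (\<Sum>t. left_dif (w 0) (t + 0) 0 * ?F t)"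
      by (rule suminf_mult[OF S(1)])
    finally show ?thesis by (simp add: n 0 neg)
  next
    case (Suc L)
    have "(\<Sum>t. left_dif (w 0) (t + 1) K * ?F t) = (\<Sum>t. w 0 * (left_dif (w 0) (t + 0) K * ?F t)
        + (1 - w 0) * (left_dif ((w(0 := 1 / 2)) 0) (t + 1) L * ?F t))"
      by (simp add: left_dif_Suc_Suc Suc algebra_simps)
    also have "\<dots> = w 0 * (\<Sum>t. left_dif (w 0) (t + 0) K * ?F t)
        + (1 - w 0) * (\<Sum>t. left_dif ((w(0 := 1 / 2)) 0) (t + 1) L * ?F t)"
      using S by (simp only: suminf_add[symmetric] suminf_mult summable_mult)
    finally show ?thesis by (simp add: n Suc neg neg')
  qed
qed

text \<open>The left jump is not made at \<open>0\<close>, so \<open>K\<close> stays. The induction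
  peels off site \<open>0\<close>; only \<open>y = 1\<close> is delicate, since there the shifted
  environment takes its step at its own boundary site.\<close>

lemma exit_cdf_step:
  assumes "cookie_env w" "0 < y" "y < int n"
  shows "exit_cdf n w y K = w y * exit_cdf n w (y + 1) K
    + (1 - w y) * exit_cdf n (w(y := 1 / 2)) (y - 1) K"
  using assms
proof (induction n arbitrary: w y K)
  case (Suc n)
  let ?s = "shift w" and ?s' = "(shift w)(y - 1 := 1 / 2)"
  have sh: "shift (w(y := 1 / 2)) = ?s'" by (auto simp: shift_def fun_eq_iff)
  have sy: "?s (y - 1) = w y" by (simp add: shift_def)
  have S: "summable (\<lambda>t. left_dif (w 0) (t + i) K * exit_cdf n ?s z t)"
    "summable (\<lambda>t. left_dif (w 0) (t + i) K * exit_cdf n ?s' z t)" for i z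
    using Suc.prems cookie_envD[OF Suc.prems(1), of 0]
    by (intro exit_cdf_summable cookie_env_upd cookie_env_shift; simp)+
  show ?case
  proof (cases "y = 1")
    case False
    have IH: "exit_cdf n ?s (y - 1) t = w y * exit_cdf n ?s y t
        + (1 - w y) * exit_cdf n ?s' (y - 2) t" for t
      using Suc.IH[of ?s "y - 1" t] Suc.prems False sy by (simp del: fun_upd_apply)
    have "(\<Sum>t. left_dif (w 0) (t + 0) K * exit_cdf n ?s (y - 1) t)
        = (\<Sum>t. w y * (left_dif (w 0) (t + 0) K * exit_cdf n ?s y t)
          + (1 - w y) * (left_dif (w 0) (t + 0) K * exit_cdf n ?s' (y - 2) t))"
      by (simp add: IH algebra_simps)
    also have "\<dots> = w y * (\<Sum>t. left_dif (w 0) (t + 0) K * exit_cdf n ?s y t)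
          + (1 - w y) * (\<Sum>t. left_dif (w 0) (t + 0) K * exit_cdf n ?s' (y - 2) t)"
      using S by (simp only: suminf_add[symmetric] suminf_mult summable_mult)
    finally show ?thesis using Suc.prems False by (simp add: sh fun_upd_other del: fun_upd_apply)
  next
    \<comment> \<open>A left jump from \<open>1\<close> lands on \<open>0\<close>. Reindexing the
      series by the left jump just spent turns offset \<open>0\<close> into offset \<open>1\<close>,
      the extra right jump required at \<open>0\<close> once the start is no longer to its
      right.\<close>
    case True
    define H where "H = exit_cdf n ?s' 0"
    have H: "exit_cdf n ?s' (- 1) = H" unfolding H_def by (rule exit_cdf_nonpos) simp
    have IH: "exit_cdf n ?s 0 t = w y * exit_cdf n ?s 1 t
        + (1 - w y) * (case t of 0 \<Rightarrow> 0 | Suc L \<Rightarrow> H L)" for t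
      using exit_cdf_step_0[of ?s n t] Suc.prems True sy
      by (simp add: H_def[unfolded True] del: fun_upd_apply cong del: nat.case_cong_weak split: nat.split)
    have T: "summable (\<lambda>t. left_dif (w 0) (t + 0) K * (case t of 0 \<Rightarrow> 0 | Suc L \<Rightarrow> H L))"
      using exit_cdf_bounds[of ?s' n 0] Suc.prems(1) cookie_envD[OF Suc.prems(1), of 0]
      by (intro summable_left_dif_mult) (auto simp: H_def split: nat.split)
    have "(\<Sum>t. left_dif (w 0) (t + 0) K * (case t of 0 \<Rightarrow> 0 | Suc L \<Rightarrow> H L))
        = (\<Sum>t. left_dif (w 0) (t + 1) K * H t)"
      using suminf_split_head[OF T] by simp
    moreover have "(\<Sum>t. left_dif (w 0) (t + 0) K * exit_cdf n ?s 0 t)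
        = (\<Sum>t. w y * (left_dif (w 0) (t + 0) K * exit_cdf n ?s 1 t)
          + (1 - w y) * (left_dif (w 0) (t + 0) K * (case t of 0 \<Rightarrow> 0 | Suc L \<Rightarrow> H L)))"
      by (simp add: IH algebra_simps)
    moreover have "\<dots> = w y * (\<Sum>t. left_dif (w 0) (t + 0) K * exit_cdf n ?s 1 t)
          + (1 - w y) * (\<Sum>t. left_dif (w 0) (t + 0) K * (case t of 0 \<Rightarrow> 0 | Suc L \<Rightarrow> H L))"
      using S T by (simp only: suminf_add[symmetric] suminf_mult summable_mult)
    ultimately show ?thesis using True H sh by (simp add: fun_upd_other del: fun_upd_apply)
  qed
qed simp

section \<open>The limit of the chain\<close>

lemma exit_cdf_0_Suc:
  "exit_cdf (Suc n) w 0 K = (\<Sum>t. left_dif (w 0) (Suc t) K * exit_cdf n (shift w) 0 t)"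
  using exit_cdf_nonpos[of "-1" n "shift w"] by simp

declare exit_cdf.simps(2) [simp del]

text \<open>Summation by parts leaves \<open>d 0 * F 0\<close> and the terms
  \<open>d (Suc t) * (F (Suc t) - F t)\<close>, all nonnegative; the boundary term vanishes because
  \<open>d\<close> tends to 0 and \<open>F\<close> is bounded.\<close>

lemma sums_mult_mono:
  fixes F :: "nat \<Rightarrow> real"
  assumes d: "\<And>t. 0 \<le> d t" "d \<longlonglongrightarrow> 0" and F: "\<And>t. F t \<le> F (Suc t)" "\<And>t. 0 \<le> F t \<and> F t \<le> 1"
    and S: "(\<lambda>t. (d t - d (Suc t)) * F t) sums x"
  shows "0 \<le> x"
proof -
  have part: "- d N \<le> (\<Sum>t<N. (d t - d (Suc t)) * F t)" for N
  proof -
    have "- d N * F N \<le> (\<Sum>t<N. (d t - d (Suc t)) * F t)"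
    proof (induction N)
      case 0
      then show ?case using d(1)[of 0] F(2)[of 0] by simp
    next
      case (Suc N)
      have "0 \<le> d (Suc N) * (F (Suc N) - F N)" using d F by simp
      with Suc show ?case by (simp add: algebra_simps)
    qed
    moreover have "d N * F N \<le> d N" using d F by (simp add: mult_left_le)
    ultimately show ?thesis by simp
  qed
  have "(\<lambda>N. - d N) \<longlonglongrightarrow> - 0" by (intro tendsto_intros d)
  with S part show ?thesis unfolding sums_def by (intro LIMSEQ_le[of "\<lambda>N. - d N" 0]) auto
qed

text \<open>The weights \<open>left_dif\<close> are not monotone in \<open>K\<close>, only their
  tail sums \<open>left_cdf\<close> are, so the comparison is made after summation by parts.\<close>

lemma exit_cdf_mono:
  assumes "cookie_env w" "K \<le> L"
  shows "exit_cdf n w 0 K \<le> exit_cdf n w 0 L"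
  using assms
proof (induction n arbitrary: w K L)
  case (Suc n)
  note b = cookie_envD[OF Suc.prems(1), of 0]
  let ?F = "exit_cdf n (shift w) 0"
  let ?d = "\<lambda>t. left_cdf (w 0) (Suc t) L - left_cdf (w 0) (Suc t) K"
  have F: "0 \<le> ?F t \<and> ?F t \<le> 1" for t using exit_cdf_bounds Suc.prems by simp
  have S: "(\<lambda>t. left_dif (w 0) (Suc t) K * ?F t) sums exit_cdf (Suc n) w 0 K" for K
    using summable_left_dif_mult[OF b(3,2) F, of 1 K] 
    unfolding exit_cdf_0_Suc by (simp add: summable_sums)
  have sums: "(\<lambda>t. (?d t - ?d (Suc t)) * ?F t) sums (exit_cdf (Suc n) w 0 L - exit_cdf (Suc n) w 0 K)"
    using sums_diff[OF S[of L] S[of K]] by (simp add: left_dif_def algebra_simps)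
  have lim: "?d \<longlonglongrightarrow> 0 - 0"
    using b by (intro tendsto_diff LIMSEQ_Suc left_cdf_tendsto_0) auto
  have "0 \<le> exit_cdf (Suc n) w 0 L - exit_cdf (Suc n) w 0 K"
  proof (rule sums_mult_mono[of ?d ?F])
    show "0 \<le> ?d t" for t using left_cdf_mono[OF b(3,4) Suc.prems(2)] by simp
    show "?F t \<le> ?F (Suc t)" for t using Suc.prems by (intro Suc.IH) auto
  qed (use F lim sums in auto)
  then show ?case by simp
qed simp

lemma exit_cdf_Suc_le:
  assumes "cookie_env w"
  shows "exit_cdf (Suc n) w 0 K \<le> exit_cdf n w 0 K"
  using assms
proof (induction n arbitrary: w K)
  case 0
  then show ?case using exit_cdf_bounds[of w 1 0 K] by simp
next
  case (Suc n)
  note b = cookie_envD[OF Suc.prems, of 0]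
  have S: "summable (\<lambda>t. left_dif (w 0) (Suc t) K * exit_cdf m (shift w) 0 t)" for m
    using exit_cdf_summable[OF b(3,2), of "shift w" 1] Suc.prems by simp
  show ?case unfolding exit_cdf_0_Suc[of "Suc n" w] exit_cdf_0_Suc[of n w]
    using Suc left_dif_nonneg[OF b(3,4)] by (intro suminf_le S mult_left_mono) auto
qed

text \<open>A limit of decreasing distribution functions, hence possibly a defective one. In a
  cookie environment its value at \<open>0\<close> is the probability that the walk from
  \<open>0\<close> never visits \<open>-1\<close>.\<close>

definition escape :: "(int \<Rightarrow> real) \<Rightarrow> nat \<Rightarrow> real" where
  "escape w K = lim (\<lambda>n. exit_cdf n w 0 K)"

lemma escape_tendsto:
  assumes "cookie_env w"
  shows "(\<lambda>n. exit_cdf n w 0 K) \<longlonglongrightarrow> escape w K"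
proof -
  have "decseq (\<lambda>n. exit_cdf n w 0 K)" using assms by (intro decseq_SucI exit_cdf_Suc_le)
  with exit_cdf_bounds[OF assms] show ?thesis unfolding escape_def
    using decseq_convergent[of _ 0] limI by metis
qed

lemma escape_le: "cookie_env w \<Longrightarrow> escape w K \<le> exit_cdf n w 0 K"
  by (rule decseq_ge[OF decseq_SucI escape_tendsto]) (auto intro: exit_cdf_Suc_le)

lemma escape_bounds: "cookie_env w \<Longrightarrow> 0 \<le> escape w K \<and> escape w K \<le> 1"
  using escape_le[of w K 0] escape_tendsto[of w K] exit_cdf_bounds[of w]
  by (auto intro: LIMSEQ_le_const)

lemma escape_mono: "cookie_env w \<Longrightarrow> K \<le> L \<Longrightarrow> escape w K \<le> escape w L"
  by (rule LIMSEQ_le[OF escape_tendsto escape_tendsto]) (auto intro: exit_cdf_mono)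

lemma escape_cong: "(\<And>x. 0 \<le> x \<Longrightarrow> w x = w' x) \<Longrightarrow> escape w = escape w'"
  using exit_cdf_cong[of w w'] by (simp add: escape_def fun_eq_iff)

text \<open>Dominated convergence with majorant \<open>left_dif\<close>. Mass lost to infinity
  contributes nothing here, in accordance with \<open>left_cdf\<close> tending to 0 in
  \<open>t\<close>.\<close>

lemma escape_sums:
  assumes "cookie_env w"
  shows "(\<lambda>t. left_dif (w 0) (Suc t) K * escape (shift w) t) sums escape w K"
proof -
  note b = cookie_envD[OF assms, of 0]
  have e: "0 \<le> escape (shift w) t \<and> escape (shift w) t \<le> 1" for t
    using escape_bounds assms by simp
  have "(\<lambda>n. \<Sum>t. left_dif (w 0) (Suc t) K * exit_cdf n (shift w) 0 t)
      \<longlonglongrightarrow> (\<Sum>t. left_dif (w 0) (Suc t) K * escape (shift w) t)"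
  proof (rule tannerys_theorem[THEN conjunct2, THEN conjunct2])
    show "(\<lambda>n. left_dif (w 0) (Suc t) K * exit_cdf n (shift w) 0 t)
        \<longlonglongrightarrow> left_dif (w 0) (Suc t) K * escape (shift w) t" for t
      using assms by (intro tendsto_intros escape_tendsto) simp
    show "\<forall>\<^sub>F (t, n) in at_top \<times>\<^sub>F sequentially.
        norm (left_dif (w 0) (Suc t) K * exit_cdf n (shift w) 0 t) \<le> left_dif (w 0) (Suc t) K"
      using left_dif_nonneg[OF b(3,4)] exit_cdf_bounds[of "shift w"] assms
      by (intro always_eventually) (auto simp: abs_mult intro: mult_left_le)
    show "summable (\<lambda>t. left_dif (w 0) (Suc t) K)"
      using left_dif_sums[OF b(3,2), of 1 K] by (simp add: sums_iff)
  qed simp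
  moreover have "(\<lambda>n. exit_cdf (Suc n) w 0 K) \<longlonglongrightarrow> escape w K"
    using escape_tendsto[OF assms] by (rule LIMSEQ_Suc)
  ultimately have "escape w K = (\<Sum>t. left_dif (w 0) (Suc t) K * escape (shift w) t)"
    unfolding exit_cdf_0_Suc by (rule LIMSEQ_unique[rotated])
  with summable_left_dif_mult[OF b(3,2) e, of 1 K] show ?thesis by (simp add: summable_sums)
qed

lemma left_dif_pos_0: "0 < p \<Longrightarrow> p < 1 \<Longrightarrow> 0 < left_dif p t 0"
  by (induction t) (simp_all add: left_dif_Suc_0 left_dif_0)

text \<open>All weights at \<open>K = 0\<close> are positive, so a vanishing series of nonnegative
  terms kills each value of \<open>escape (shift w)\<close>. Together with the converse this makes
  \<open>escape w 0 = 0\<close> a shift-invariant property, to which ergodicity can be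
  applied.\<close>

lemma escape_0_imp_shift:
  assumes w: "cookie_env w" and 0: "escape w 0 = 0"
  shows "escape (shift w) t = 0"
proof -
  note b = cookie_envD[OF w, of 0]
  have "(\<lambda>t. left_dif (w 0) (Suc t) 0 * escape (shift w) t) sums 0"
    using escape_sums[OF w, of 0] 0 by simp
  moreover have "0 \<le> left_dif (w 0) (Suc t) 0 * escape (shift w) t" for t
    using left_dif_nonneg[OF b(3,4)] escape_bounds[of "shift w"] w by simp
  ultimately have "left_dif (w 0) (Suc t) 0 * escape (shift w) t = 0"
    using suminf_eq_zero_iff[of "\<lambda>t. left_dif (w 0) (Suc t) 0 * escape (shift w) t"]
    by (simp add: sums_iff)
  with left_dif_pos_0[OF b(5,2)] show ?thesis by (metis mult_eq_0_iff less_irrefl)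
qed

lemma escape_shift_0_imp:
  assumes w: "cookie_env w" and 0: "\<And>t. escape (shift w) t = 0"
  shows "escape w K = 0"
  using escape_sums[OF w, of K] 0 by (simp add: sums_iff)

lemma escape_0_iff:
  assumes w: "cookie_env w"
  shows "escape w K = 0 \<longleftrightarrow> escape w 0 = 0"
  using escape_0_imp_shift[OF w] escape_shift_0_imp[OF w] escape_bounds[OF w, of 0]
    escape_mono[OF w, of 0 K] by force

lemma escape_shift_0_iff: "cookie_env w \<Longrightarrow> escape (shift w) 0 = 0 \<longleftrightarrow> escape w 0 = 0"
  using escape_0_imp_shift escape_shift_0_imp escape_0_iff[of "shift w"] by (metis cookie_env_shift)

text \<open>The weak limit of the left-jump counts conditioned to be finite is again consistent
  under the one-site transition, and it dominates the count started from \<open>0\<close>. Hence a limit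
  with some finite mass has no mass at infinity.\<close>

lemma escape_tendsto_1:
  assumes w: "cookie_env w" and pos: "escape w 0 \<noteq> 0"
  shows "escape w \<longlonglongrightarrow> 1"
proof -
  define mass where "mass w = (SUP K. escape w K)" for w
  have lim: "escape w \<longlonglongrightarrow> mass w" and up: "escape w K \<le> mass w" if "cookie_env w" for w K
  proof -
    have bdd: "bdd_above (range (escape w))"
      using escape_bounds[OF that] by (auto intro!: bdd_aboveI[of _ 1])
    then show "escape w \<longlonglongrightarrow> mass w" unfolding mass_def
      using escape_mono[OF that] by (intro LIMSEQ_incseq_SUP) (auto simp: incseq_def)
    show "escape w K \<le> mass w" unfolding mass_def using bdd by (intro cSUP_upper) auto
  qed
  \<comment> \<open>A finite count at site \<open>1\<close> forces a finite count at
    \<open>0\<close>: keep only the part \<open>s \<ge> t\<close> of the series and let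
    \<open>K\<close> tend to infinity.\<close>
  have shift_le: "mass (shift w) \<le> mass w" if w: "cookie_env w" for w
  proof (rule LIMSEQ_le_const2[OF lim[OF cookie_env_shift[OF w]]], intro exI allI impI)
    fix t
    note b = cookie_envD[OF w, of 0]
    have "left_cdf (w 0) (Suc t) K * escape (shift w) t \<le> escape w K" for K
    proof (rule sums_le)
      show "(\<lambda>s. if s < t then 0 else left_dif (w 0) (Suc s) K * escape (shift w) t)
          sums (left_cdf (w 0) (Suc t) K * escape (shift w) t)"
      proof -
        let ?f = "\<lambda>s. if s < t then 0 else left_dif (w 0) (Suc s) K * escape (shift w) t"
        have "(\<lambda>s. ?f (s + t)) sums (left_cdf (w 0) (Suc t) K * escape (shift w) t)"
          using sums_mult2[OF left_dif_sums[OF b(3,2), of "Suc t" K], of "escape (shift w) t"] by simp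
        moreover have "sum ?f {..<t} = 0" by (intro sum.neutral) auto
        ultimately show ?thesis using sums_iff_shift[of ?f t] by simp
      qed
      show "(\<lambda>t. left_dif (w 0) (Suc t) K * escape (shift w) t) sums escape w K"
        by (rule escape_sums[OF w])
      show "(if s < t then 0 else left_dif (w 0) (Suc s) K * escape (shift w) t)
          \<le> left_dif (w 0) (Suc s) K * escape (shift w) s" for s
        using left_dif_nonneg[OF b(3,4)] escape_bounds[of "shift w"] escape_mono[of "shift w" t s] w
        by (auto intro: mult_left_mono)
    qed
    moreover have "(\<lambda>K. left_cdf (w 0) (Suc t) K * escape (shift w) t) \<longlonglongrightarrow> 1 * escape (shift w) t"
      using b by (intro tendsto_intros left_cdf_tendsto_1) auto
    ultimately show "escape (shift w) t \<le> mass w"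
      by (intro LIMSEQ_le[OF _ lim[OF w], of _ "escape (shift w) t"]) auto
  qed
  \<comment> \<open>The inequality for \<open>mass (shift w)\<close> lets one factor
    \<open>mass w\<close> be carried through the whole induction; at \<open>n = 0\<close> the claim
    is that \<open>mass w\<close> is an upper bound.\<close>
  have dom: "escape w K \<le> mass w * exit_cdf n w 0 K" if "cookie_env w" for n w K
    using that
  proof (induction n arbitrary: w K)
    case (Suc n)
    note b = cookie_envD[OF Suc.prems, of 0]
    have sw: "cookie_env (shift w)" using Suc.prems by simp
    have "summable (\<lambda>t. left_dif (w 0) (Suc t) K * exit_cdf n (shift w) 0 t)"
      using exit_cdf_summable[OF b(3,2) sw, of 1] by simp
    then have S: "(\<lambda>t. mass w * (left_dif (w 0) (Suc t) K * exit_cdf n (shift w) 0 t))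
        sums (mass w * exit_cdf (Suc n) w 0 K)"
      unfolding exit_cdf_0_Suc by (intro sums_mult) (rule summable_sums)
    show ?case
    proof (rule sums_le[OF _ escape_sums[OF Suc.prems] S])
      fix t
      have "escape (shift w) t \<le> mass (shift w) * exit_cdf n (shift w) 0 t"
        by (rule Suc.IH[OF sw])
      also have "\<dots> \<le> mass w * exit_cdf n (shift w) 0 t"
        by (intro mult_right_mono shift_le Suc.prems conjunct1[OF exit_cdf_bounds] sw)
      finally show "left_dif (w 0) (Suc t) K * escape (shift w) t
          \<le> mass w * (left_dif (w 0) (Suc t) K * exit_cdf n (shift w) 0 t)"
        using mult_left_mono[OF _ left_dif_nonneg[OF b(3,4), of "Suc t" K]]
        by (simp only: mult.left_commute[of "mass w"])
    qed
  qed (use up in simp)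
  \<comment> \<open>As \<open>n\<close> tends to infinity at \<open>K = 0\<close>, the same positive
    number \<open>escape w 0\<close> appears on both sides and can be cancelled.\<close>
  have "escape w 0 \<le> mass w * escape w 0"
    using dom[OF w, of 0] by (intro LIMSEQ_le_const[OF tendsto_mult_left[OF escape_tendsto[OF w]]]) auto
  moreover have "0 < escape w 0" using pos escape_bounds[OF w, of 0] by simp
  ultimately have "1 \<le> mass w" by simp
  moreover have "mass w \<le> 1"
    using escape_bounds[OF w] by (intro LIMSEQ_le_const2[OF lim[OF w]]) auto
  ultimately show ?thesis using lim[OF w] by simp
qed

section \<open>Moments\<close>

lemma left_dif_0_eq: "left_dif p 0 (Suc K) = (1 - p) * left_dif (1 / 2) 0 K"
  by (simp add: left_dif_def algebra_simps)

text \<open>General weights \<open>a\<close> serve both means (\<open>a K = 1\<close>) and second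
  moments (\<open>a K = 1 + K\<close>). The sums are truncated at \<open>J\<close> so that
  summability follows from uniform bounds.\<close>

lemma sum_left_dif_0:
  "(\<Sum>K<Suc J. a K * left_dif p 0 K)
    = (1 - p) * (a 0 + (\<Sum>K<J. a (Suc K) * left_dif (1 / 2) 0 K))"
  by (simp add: sum.lessThan_Suc_shift left_dif_0_eq left_dif_0 sum_distrib_left algebra_simps
      del: sum.lessThan_Suc)

lemma sum_left_dif_Suc:
  "(\<Sum>K<Suc J. a K * left_dif p (Suc t) K)
    = p * (\<Sum>K<Suc J. a K * left_dif p t K)
      + (1 - p) * (\<Sum>K<J. a (Suc K) * left_dif (1 / 2) (Suc t) K)"
  by (simp add: sum.lessThan_Suc_shift left_dif_Suc_0 left_dif_Suc_Suc sum_distrib_left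
      sum.distrib sum_subtractf algebra_simps del: sum.lessThan_Suc)

lemma sum_half_le: "(\<Sum>K<J. left_dif (1 / 2) t K) \<le> 1"
proof (induction t arbitrary: J)
  case 0
  show ?case
  proof (induction J)
    case (Suc J)
    then show ?case using sum_left_dif_0[of "\<lambda>_. 1" "1/2" J] by simp
  qed simp
next
  case (Suc t)
  note IH = Suc
  show ?case
  proof (induction J)
    case (Suc J)
    then show ?case using sum_left_dif_Suc[of "\<lambda>_. 1" "1/2" t J] IH[of "Suc J"]
      by (simp del: sum.lessThan_Suc)
  qed simp
qed

lemma sum_left_dif_le:
  assumes "0 \<le> p" "p \<le> 1"
  shows "(\<Sum>K<J. left_dif p t K) \<le> 2"
proof (induction t arbitrary: J)
  case 0
  show ?case
  proof (cases J)
    case (Suc J)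
    have "(1 - p) * (1 + (\<Sum>K<J. left_dif (1 / 2) 0 K)) \<le> 1 * 2"
      using sum_half_le[of 0 J] assms left_dif_nonneg[of "1/2"]
      by (intro mult_mono) (auto intro!: add_nonneg_nonneg sum_nonneg)
    then show ?thesis using sum_left_dif_0[of "\<lambda>_. 1" p J] Suc by simp
  qed simp
next
  case (Suc t)
  show ?case
  proof (cases J)
    case (Suc J')
    have "p * (\<Sum>K<J. left_dif p t K) + (1 - p) * (\<Sum>K<J'. left_dif (1 / 2) (Suc t) K) \<le> 2"
      using sum_half_le[of "Suc t" J'] assms Suc.IH[of J] by (intro convex_bound_le) auto
    then show ?thesis using sum_left_dif_Suc[of "\<lambda>_. 1" p t J'] Suc by simp
  qed simp
qed

text \<open>With \<open>N\<close> left jumps before the \<open>t\<close>-th right jump and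
  \<open>G\<close> more before the next, the full sum is the mean of
  \<open>N * G + G * (G + 1) / 2\<close>. At a fair site \<open>N\<close> has mean \<open>t\<close>,
  and \<open>G\<close> is independent with mean 1 and second moment 3, which gives
  \<open>t + 2\<close>.\<close>

lemma sum_half_weighted_le: "(\<Sum>K<J. (1 + real K) * left_dif (1 / 2) t K) \<le> real t + 2"
proof (induction t arbitrary: J)
  case 0
  show ?case
  proof (induction J)
    case (Suc J)
    then show ?case using sum_left_dif_0[of "\<lambda>K. 1 + real K" "1/2" J] sum_half_le[of 0 J]
      by (simp add: sum.distrib sum_distrib_left[symmetric] ring_distribs del: sum.lessThan_Suc)
  qed simp
next
  case (Suc t)
  note IH = Suc
  show ?case
  proof (induction J)
    case (Suc J)
    then show ?case using sum_left_dif_Suc[of "\<lambda>K. 1 + real K" "1/2" t J] IH[of "Suc J"]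
      sum_half_le[of "Suc t" J]
      by (simp add: sum.distrib sum_distrib_left[symmetric] ring_distribs del: sum.lessThan_Suc)
  qed simp
qed

text \<open>The left jump that consumes the cookie shifts the index by one, after which a fair site
  contributes at most \<open>t + 2 + 1\<close>. The case \<open>t = 0\<close> uses
  \<open>1 - p \<le> 1 / 2\<close>.\<close>

lemma sum_weighted_le:
  assumes "1 / 2 \<le> p" "p \<le> 1"
  shows "(\<Sum>K<J. (1 + real K) * left_dif p t K) \<le> real t + 3"
proof -
  have w: "(\<Sum>K<J. (1 + real (Suc K)) * left_dif (1 / 2) t K) \<le> real t + 3" for t J
    using sum_half_weighted_le[where t = t and J = J] sum_half_le[of t J]
    by (simp add: sum.distrib sum_distrib_left[symmetric] ring_distribs)
  have nn: "0 \<le> (\<Sum>K<J. (1 + real (Suc K)) * left_dif (1 / 2) t K)" for t J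
    using left_dif_nonneg[of "1/2"] by (intro sum_nonneg) auto
  show ?thesis
  proof (induction t arbitrary: J)
    case 0
    show ?case
    proof (cases J)
      case (Suc J')
      have "(1 - p) * (1 + (\<Sum>K<J'. (1 + real (Suc K)) * left_dif (1 / 2) 0 K)) \<le> 1 / 2 * 4"
        using w[of 0 J'] nn[of 0 J'] assms by (intro mult_mono) auto
      then show ?thesis using sum_left_dif_0[of "\<lambda>K. 1 + real K" p J'] Suc by simp
    qed simp
  next
    case (Suc t)
    show ?case
    proof (cases J)
      case (Suc J')
      have "p * (\<Sum>K<J. (1 + real K) * left_dif p t K)
          + (1 - p) * (\<Sum>K<J'. (1 + real (Suc K)) * left_dif (1 / 2) (Suc t) K) \<le> real t + 4"
        using w[where t = "Suc t" and J = J'] assms Suc.IH[of J]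
        by (intro convex_bound_le) auto
      then show ?thesis using sum_left_dif_Suc[of "\<lambda>K. 1 + real K" p t J'] Suc by simp
    qed simp
  qed
qed

lemma summable_left_dif:
  assumes "0 \<le> p" "p \<le> 1"
  shows "summable (left_dif p t)"
  by (rule summableI_nonneg_bounded[OF left_dif_nonneg sum_left_dif_le]) (use assms in auto)

lemma summable_left_dif_weighted:
  assumes "1 / 2 \<le> p" "p \<le> 1"
  shows "summable (\<lambda>K. (1 + real K) * left_dif p t K)"
  by (rule summableI_nonneg_bounded[OF _ sum_weighted_le])
    (use assms left_dif_nonneg[of p t] in auto)

lemma suminf_left_dif_0:
  assumes "0 \<le> p" "p \<le> 1"
  shows "suminf (left_dif p 0) = 2 * (1 - p)"
proof -
  have *: "suminf (left_dif p 0) = (1 - p) * (1 + suminf (left_dif (1 / 2) 0))"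
    if "0 \<le> p" "p \<le> 1" for p
    using suminf_split_head[OF summable_left_dif[OF that, of 0]]
      suminf_mult[OF summable_left_dif[of "1/2" 0], of "1 - p"]
    by (simp add: left_dif_0_eq left_dif_0 algebra_simps)
  from *[of "1/2"] have "suminf (left_dif (1 / 2) 0) = 1" by simp
  with *[OF assms] show ?thesis by simp
qed

lemma suminf_left_dif_Suc:
  assumes "0 \<le> p" "p \<le> 1"
  shows "suminf (left_dif p (Suc t)) = p * suminf (left_dif p t)
    + (1 - p) * suminf (left_dif (1 / 2) (Suc t))"
proof -
  note S = summable_left_dif[OF assms, of t] summable_left_dif[of "1/2" "Suc t"]
  have "suminf (left_dif p (Suc t))
      = (\<Sum>K. p * left_dif p t (Suc K) + (1 - p) * left_dif (1 / 2) (Suc t) K) + p * left_dif p t 0"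
    using suminf_split_head[OF summable_left_dif[OF assms, of "Suc t"]]
    by (simp add: left_dif_Suc_0 left_dif_Suc_Suc)
  also have "(\<Sum>K. p * left_dif p t (Suc K) + (1 - p) * left_dif (1 / 2) (Suc t) K)
      = p * (suminf (left_dif p t) - left_dif p t 0) + (1 - p) * suminf (left_dif (1 / 2) (Suc t))"
    using S by (subst suminf_add[symmetric])
      (auto simp: summable_Suc_iff suminf_mult suminf_split_head intro!: summable_mult)
  finally show ?thesis by (simp add: algebra_simps)
qed

text \<open>This is the mean number of left jumps between the \<open>t\<close>-th and the next right
  jump. For a fair coin it is 1; with probability \<open>p ^ t\<close> the cookie is still there,
  and then it is \<open>2 * (1 - p)\<close>, since a left jump is followed by one more on
  average.\<close>

lemma left_dif_column_sums:
  assumes "0 \<le> p" "p \<le> 1"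
  shows "left_dif p t sums (1 - p ^ t * (2 * p - 1))"
proof -
  have half: "suminf (left_dif (1 / 2) t) = 1" for t
    using suminf_left_dif_0[of "1/2"] suminf_left_dif_Suc[of "1/2"] by (induction t) (auto simp: field_simps)
  have "suminf (left_dif p t) = 1 - p ^ t * (2 * p - 1)"
  proof (induction t)
    case (Suc t)
    show ?case unfolding suminf_left_dif_Suc[OF assms] half Suc by (simp add: algebra_simps)
  qed (simp add: suminf_left_dif_0[OF assms])
  with summable_sums[OF summable_left_dif[OF assms, of t]] show ?thesis by simp
qed

lemma sums_swap_nonneg:
  fixes f :: "nat \<Rightarrow> nat \<Rightarrow> real"
  assumes f: "\<And>t K. 0 \<le> f t K" and g: "\<And>t. (\<lambda>K. f t K) sums g t"
    and h: "\<And>K. (\<lambda>t. f t K) sums h K" and s: "g sums s"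
  shows "h sums s"
proof -
  have g0: "0 \<le> g t" and h0: "0 \<le> h K" for t K
    using g[of t] h[of K] f sums_le[of "\<lambda>_. 0"] sums_zero by metis+
  have s0: "0 \<le> s" using s g0 sums_le[of "\<lambda>_. 0"] sums_zero by metis
  have "(\<Sum>K. ennreal (h K)) = (\<integral>\<^sup>+K. (\<Sum>t. ennreal (f t K)) \<partial>count_space UNIV)"
    by (simp add: nn_integral_count_space_nat suminf_ennreal_eq[OF f h])
  also have "\<dots> = (\<Sum>t. \<integral>\<^sup>+K. ennreal (f t K) \<partial>count_space UNIV)"
    by (rule nn_integral_suminf) simp
  also have "\<dots> = (\<Sum>t. ennreal (g t))"
    by (simp add: nn_integral_count_space_nat suminf_ennreal_eq[OF f g])
  also have "\<dots> = ennreal s" by (rule suminf_ennreal_eq[OF g0 s])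
  finally have "(\<lambda>K. ennreal (h K)) sums ennreal s" by (simp add: sums_iff)
  then show ?thesis using h0 s0 by (simp add: sums_ennreal)
qed

section \<open>Tails, mean and second moment of the count at \<open>0\<close>\<close>

definition left_tail :: "nat \<Rightarrow> (int \<Rightarrow> real) \<Rightarrow> nat \<Rightarrow> real" where
  "left_tail n w K = 1 - exit_cdf n w 0 K"

lemma left_tail_bounds: "cookie_env w \<Longrightarrow> 0 \<le> left_tail n w K \<and> left_tail n w K \<le> 1"
  using exit_cdf_bounds[of w n 0 K] by (simp add: left_tail_def)

lemma left_tail_step:
  assumes "cookie_env w"
  shows "(\<lambda>t. left_dif (w 0) (Suc t) K * left_tail n (shift w) t)
    sums (left_tail (Suc n) w K - left_dif (w 0) 0 K)"
proof -
  note b = cookie_envD[OF assms, of 0]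
  have "(\<lambda>t. left_dif (w 0) (Suc t) K * exit_cdf n (shift w) 0 t) sums exit_cdf (Suc n) w 0 K"
    unfolding exit_cdf_0_Suc using exit_cdf_summable[OF b(3,2), of "shift w" 1] assms
    by (intro summable_sums) simp
  with sums_diff[OF left_dif_sums[OF b(3,2), of 1 K]]
  have "(\<lambda>t. left_dif (w 0) (Suc t) K - left_dif (w 0) (Suc t) K * exit_cdf n (shift w) 0 t)
      sums (left_cdf (w 0) 1 K - exit_cdf (Suc n) w 0 K)" by simp
  then show ?thesis by (simp add: left_tail_def left_dif_def[of _ 0] algebra_simps)
qed

lemma left_tail_0 [simp]: "left_tail 0 w = (\<lambda>K. 0)"
  by (simp add: left_tail_def fun_eq_iff)

definition mean_left :: "nat \<Rightarrow> (int \<Rightarrow> real) \<Rightarrow> real" where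
  "mean_left n w = suminf (left_tail n w)"

text \<open>If the count \<open>u\<close> at site \<open>1\<close> has distribution function
  \<open>F\<close> and \<open>p = w 0\<close>, the sum of \<open>p ^ Suc t * F t\<close> is
  \<open>p / (1 - p)\<close> times the mean of \<open>p ^ u\<close>. So this is the change of the
  mean at one site, averaged over \<open>u\<close>.\<close>

definition mean_drift :: "nat \<Rightarrow> (int \<Rightarrow> real) \<Rightarrow> real" where
  "mean_drift n w = 2 - w 0 / (1 - w 0)
     + (2 * w 0 - 1) * (\<Sum>t. w 0 ^ Suc t * exit_cdf n (shift w) 0 t)"

lemma power_Suc_sums: "0 \<le> p \<Longrightarrow> p < 1 \<Longrightarrow> (\<lambda>t. p ^ Suc t) sums (p / (1 - p))" for p :: real
  using sums_mult[OF geometric_sums[of p], of p] by simp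

lemma summable_power_mult:
  fixes p :: real
  assumes "0 \<le> p" "p < 1" "\<And>t. 0 \<le> F t \<and> F t \<le> 1"
  shows "summable (\<lambda>t. p ^ Suc t * F t)"
proof (rule summable_comparison_test'[OF sums_summable[OF power_Suc_sums[OF assms(1,2)]]])
  show "norm (p ^ Suc t * F t) \<le> p ^ Suc t" for t
    using assms by (simp add: abs_mult mult_left_le del: power_Suc)
qed

text \<open>Exchanging the sums over \<open>K\<close> and \<open>t\<close> replaces the weights by
  their column sums, that is 1 minus a cookie correction; the isolated column \<open>t = 0\<close>
  contributes \<open>2 - 2 * w 0\<close>.\<close>

lemma mean_left_step:
  assumes w: "cookie_env w" and S: "summable (left_tail n (shift w))"
  shows "left_tail (Suc n) w sums (mean_left n (shift w) + mean_drift n w)"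
proof -
  note b = cookie_envD[OF w, of 0]
  let ?p = "w 0" and ?T = "left_tail n (shift w)" and ?C = "exit_cdf n (shift w) 0"
  have C: "0 \<le> ?C t \<and> ?C t \<le> 1" for t using exit_cdf_bounds w by simp
  have "(\<lambda>t. ?p ^ Suc t - ?p ^ Suc t * ?C t) sums (?p / (1 - ?p) - (\<Sum>t. ?p ^ Suc t * ?C t))"
    by (intro sums_diff power_Suc_sums b summable_sums summable_power_mult C)
  then have "(\<lambda>t. ?p ^ Suc t * ?T t) sums (?p / (1 - ?p) - (\<Sum>t. ?p ^ Suc t * ?C t))"
    by (simp add: left_tail_def algebra_simps)
  from sums_diff[OF summable_sums[OF S] sums_mult[OF this, of "2 * ?p - 1"]]
  have G: "(\<lambda>t. (1 - ?p ^ Suc t * (2 * ?p - 1)) * ?T t)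
      sums (mean_left n (shift w) - (2 * ?p - 1) * (?p / (1 - ?p) - (\<Sum>t. ?p ^ Suc t * ?C t)))"
    by (simp add: mean_left_def algebra_simps)
  have "(\<lambda>K. left_tail (Suc n) w K - left_dif ?p 0 K)
      sums (mean_left n (shift w) - (2 * ?p - 1) * (?p / (1 - ?p) - (\<Sum>t. ?p ^ Suc t * ?C t)))"
  proof (rule sums_swap_nonneg[OF _ _ _ G])
    show "0 \<le> left_dif ?p (Suc t) K * ?T t" for t K
      using left_dif_nonneg[OF b(3,4)] left_tail_bounds[of "shift w"] w by simp
    show "(\<lambda>K. left_dif ?p (Suc t) K * ?T t) sums ((1 - ?p ^ Suc t * (2 * ?p - 1)) * ?T t)" for t
      by (intro sums_mult2 left_dif_column_sums b)
    show "(\<lambda>t. left_dif ?p (Suc t) K * ?T t) sums (left_tail (Suc n) w K - left_dif ?p 0 K)" for K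
      by (rule left_tail_step[OF w])
  qed
  from sums_add[OF this left_dif_column_sums[OF b(3,4), of 0]]
  have "left_tail (Suc n) w sums (mean_left n (shift w)
      - (2 * ?p - 1) * (?p / (1 - ?p) - (\<Sum>t. ?p ^ Suc t * ?C t)) + (2 - 2 * ?p))" by simp
  moreover have "2 - 2 * ?p - (2 * ?p - 1) * (?p / (1 - ?p)) = 2 - ?p / (1 - ?p)"
    using b by (simp add: field_simps)
  then have "mean_left n (shift w) - (2 * ?p - 1) * (?p / (1 - ?p) - (\<Sum>t. ?p ^ Suc t * ?C t)) + (2 - 2 * ?p)
      = mean_left n (shift w) + mean_drift n w"
    unfolding mean_drift_def right_diff_distrib by linarith
  ultimately show ?thesis by (simp only:)
qed

lemma summable_left_tail: "cookie_env w \<Longrightarrow> summable (left_tail n w)"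
proof (induction n arbitrary: w)
  case (Suc n)
  then show ?case using mean_left_step[of w n] by (auto simp: sums_iff)
qed simp

lemma mean_left_0 [simp]: "mean_left 0 w = 0"
  by (simp add: mean_left_def)

lemma mean_left_Suc: "cookie_env w \<Longrightarrow> mean_left (Suc n) w = mean_left n (shift w) + mean_drift n w"
  using mean_left_step[of w n] summable_left_tail[of "shift w" n] by (simp add: mean_left_def sums_iff)

lemma mean_left_nonneg: "cookie_env w \<Longrightarrow> 0 \<le> mean_left n w"
  unfolding mean_left_def using left_tail_bounds by (intro suminf_nonneg summable_left_tail) auto

text \<open>The extreme case is a count of \<open>0\<close> at site \<open>1\<close>, with change
  \<open>2 - 2 * w 0\<close>. The bound yields means of at most \<open>n\<close> and makes
  \<open>1 - mean_drift\<close> nonnegative, as Fatou's lemma requires.\<close>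

lemma mean_drift_le_1:
  assumes "cookie_env w"
  shows "mean_drift n w \<le> 1"
proof -
  note b = cookie_envD[OF assms, of 0]
  have C: "0 \<le> exit_cdf n (shift w) 0 t \<and> exit_cdf n (shift w) 0 t \<le> 1" for t
    using exit_cdf_bounds assms by simp
  have "(\<Sum>t. w 0 ^ Suc t * exit_cdf n (shift w) 0 t) \<le> (\<Sum>t. w 0 ^ Suc t)"
    using C b by (intro suminf_le summable_power_mult sums_summable[OF power_Suc_sums])
      (auto intro: mult_left_le)
  also have "\<dots> = w 0 / (1 - w 0)" using power_Suc_sums[OF b(3,2)] by (simp add: sums_iff)
  finally have "mean_drift n w \<le> 2 - w 0 / (1 - w 0) + (2 * w 0 - 1) * (w 0 / (1 - w 0))"
    unfolding mean_drift_def using b by (intro add_left_mono mult_left_mono) auto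
  also have "\<dots> = 2 - 2 * ((1 - w 0) * (w 0 / (1 - w 0)))" by (simp only: ring_distribs)
  also have "\<dots> = 2 - 2 * w 0" using b by simp
  finally show ?thesis using b by simp
qed

lemma mean_left_le: "cookie_env w \<Longrightarrow> mean_left n w \<le> real n"
proof (induction n arbitrary: w)
  case (Suc n)
  from Suc.IH[OF cookie_env_shift[OF Suc.prems]] show ?case
    using mean_left_Suc[OF Suc.prems, of n] mean_drift_le_1[OF Suc.prems, of n] by simp
qed simp

text \<open>The series is the mean of \<open>Z * (Z + 1) / 2\<close> for the count \<open>Z\<close>.
  One more site adds at most three times the old mean, itself at most \<open>n\<close>, plus 3; and
  \<open>3 * n ^ 2 + 3 * n + 3 \<le> 3 * (n + 1) ^ 2\<close>.\<close>

lemma second_moment: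
  assumes "cookie_env w"
  shows "summable (\<lambda>K. (1 + real K) * left_tail n w K)
    \<and> (\<Sum>K. (1 + real K) * left_tail n w K) \<le> 3 * real n ^ 2"
  using assms
proof (induction n arbitrary: w)
  case 0
  then show ?case by (simp add: left_tail_def)
next
  case (Suc n)
  note w = Suc.prems
  note b = cookie_envD[OF w, of 0]
  have sw: "cookie_env (shift w)" using w by simp
  let ?p = "w 0" and ?T = "left_tail n (shift w)"
  note IH = Suc.IH[OF sw] and T = left_tail_bounds[OF sw, of n]
  define B where "B t = (\<Sum>K. (1 + real K) * left_dif ?p t K)" for t
  have B: "(\<lambda>K. (1 + real K) * left_dif ?p t K) sums B t" for t
    unfolding B_def by (intro summable_sums summable_left_dif_weighted b)
  have B_le: "B t \<le> real t + 3" for t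
    unfolding B_def using sum_weighted_le[OF b(1,4)]
    by (intro suminf_le_const summable_left_dif_weighted b) auto
  have B0: "0 \<le> B t" for t
    unfolding B_def using left_dif_nonneg[OF b(3,4)]
    by (intro suminf_nonneg summable_left_dif_weighted b) auto
  have bound: "B (Suc t) * ?T t \<le> (1 + real t) * ?T t + 3 * ?T t" for t
    using mult_right_mono[OF B_le[of "Suc t"], of "?T t"] T by (simp add: algebra_simps)
  have SB: "summable (\<lambda>t. (1 + real t) * ?T t + 3 * ?T t)"
    using IH by (intro summable_add summable_mult summable_left_tail sw) auto
  have SG: "summable (\<lambda>t. B (Suc t) * ?T t)"
    using bound B0 T by (intro summable_comparison_test'[OF SB]) auto
  have "(\<Sum>t. B (Suc t) * ?T t) \<le> (\<Sum>t. (1 + real t) * ?T t + 3 * ?T t)"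
    using bound by (intro suminf_le SG SB)
  also have "\<dots> = (\<Sum>t. (1 + real t) * ?T t) + 3 * mean_left n (shift w)"
    using IH summable_left_tail[OF sw, of n]
    by (simp add: suminf_add[symmetric] suminf_mult summable_mult mean_left_def)
  also have "\<dots> \<le> 3 * real n ^ 2 + 3 * real n"
    using IH mean_left_le[OF sw, of n] by simp
  finally have le: "(\<Sum>t. B (Suc t) * ?T t) \<le> 3 * real n ^ 2 + 3 * real n" .
  have "(\<lambda>K. (1 + real K) * (left_tail (Suc n) w K - left_dif ?p 0 K)) sums (\<Sum>t. B (Suc t) * ?T t)"
  proof (rule sums_swap_nonneg[OF _ _ _ summable_sums[OF SG]])
    show "0 \<le> (1 + real K) * left_dif ?p (Suc t) K * ?T t" for t K
      using left_dif_nonneg[OF b(3,4)] T by simp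
    show "(\<lambda>K. (1 + real K) * left_dif ?p (Suc t) K * ?T t) sums (B (Suc t) * ?T t)" for t
      by (intro sums_mult2 B)
    show "(\<lambda>t. (1 + real K) * left_dif ?p (Suc t) K * ?T t)
        sums ((1 + real K) * (left_tail (Suc n) w K - left_dif ?p 0 K))" for K
      using sums_mult[OF left_tail_step[OF w]] by (simp add: mult.assoc)
  qed
  from sums_add[OF this B[of 0]]
  have "(\<lambda>K. (1 + real K) * left_tail (Suc n) w K) sums ((\<Sum>t. B (Suc t) * ?T t) + B 0)"
    by (simp add: algebra_simps)
  moreover have "(\<Sum>t. B (Suc t) * ?T t) + B 0 \<le> 3 * real (Suc n) ^ 2"
    using le B_le[of 0] by (simp add: power2_eq_square algebra_simps)
  ultimately show ?case by (simp add: sums_iff)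
qed

text \<open>The tail sum is cut at \<open>A\<close> and \<open>A + B * n\<close>. Below, terms are
  at most 1; in between they are at most \<open>1 - escape w A\<close>, uniformly in
  \<open>n\<close>; beyond, the weight \<open>(1 + K) / (B * n)\<close> is at least 1 and the second
  moment leaves \<open>3 * n / B\<close>.\<close>

lemma mean_left_le_escape:
  assumes w: "cookie_env w" and n: "n > 0" and B: "B > 0"
  shows "mean_left n w \<le> real A + real (B * n) * (1 - escape w A) + 3 * real n / real B"
proof -
  let ?T = "left_tail n w" and ?N = "B * n"
  have N: "real ?N > 0" using n B by simp
  let ?g = "\<lambda>K. (if K < A then 1 else 0)
      + (if K \<in> {A..<A + ?N} then 1 - escape w A else 0) + (1 / ?N) * ((1 + real K) * ?T K)"
  have e: "0 \<le> 1 - escape w A" using escape_bounds[OF w, of A] by simp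
  have pt: "?T K \<le> ?g K" for K
  proof -
    note T = left_tail_bounds[OF w, of n K]
    have nn: "0 \<le> (1 / ?N) * ((1 + real K) * ?T K)" using T N by simp
    consider "K < A" | "K \<in> {A..<A + ?N}" | "A + ?N \<le> K" by fastforce
    then show ?thesis
    proof cases
      case 1
      then have "?g K = 1 + (1 / ?N) * ((1 + real K) * ?T K)" by simp
      with T nn show ?thesis by linarith
    next
      case 2
      have "?T K \<le> 1 - escape w A"
        using 2 exit_cdf_mono[OF w, of A K n] escape_le[OF w, of A n] by (simp add: left_tail_def)
      with 2 nn show ?thesis by simp
    next
      case 3
      have "real ?N \<le> 1 + real K" using 3 by linarith
      then have "real ?N * ?T K \<le> (1 + real K) * ?T K" using T by (intro mult_right_mono) auto
      with 3 N show ?thesis by (simp add: field_simps del: of_nat_mult)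
    qed
  qed
  have s1: "(\<lambda>K. if K < A then 1 else 0 :: real) sums real A"
    using sums_If_finite_set[of "{..<A}" "\<lambda>_. 1::real"] by simp
  have s2: "(\<lambda>K. if K \<in> {A..<A + ?N} then 1 - escape w A else 0) sums (real ?N * (1 - escape w A))"
    using sums_If_finite_set[of "{A..<A + ?N}" "\<lambda>_. 1 - escape w A"] by simp
  have s3: "(\<lambda>K. (1 / ?N) * ((1 + real K) * ?T K)) sums ((1 / ?N) * (\<Sum>K. (1 + real K) * ?T K))"
    using second_moment[OF w, of n] by (intro sums_mult summable_sums) auto
  have "mean_left n w \<le> real A + real ?N * (1 - escape w A) + (1 / ?N) * (\<Sum>K. (1 + real K) * ?T K)"
    using sums_le[OF pt summable_sums[OF summable_left_tail[OF w]] sums_add[OF sums_add[OF s1 s2] s3]]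
    by (simp add: mean_left_def)
  also have "(1 / ?N) * (\<Sum>K. (1 + real K) * ?T K) \<le> (1 / ?N) * (3 * real n ^ 2)"
    using second_moment[OF w, of n] N by (intro mult_left_mono) auto
  also have "(1 / ?N) * (3 * real n ^ 2) = 3 * real n / real B"
    using n B by (simp add: field_simps power2_eq_square)
  finally show ?thesis by simp
qed

section \<open>The limiting drift\<close>

definition limit_drift :: "(int \<Rightarrow> real) \<Rightarrow> real" where
  "limit_drift w = 2 - w 0 / (1 - w 0) + (2 * w 0 - 1) * (\<Sum>t. w 0 ^ Suc t * escape (shift w) t)"

lemma mean_drift_decseq:
  assumes w: "cookie_env w"
  shows "mean_drift (Suc n) w \<le> mean_drift n w"
proof -
  note b = cookie_envD[OF w, of 0]
  have "(\<Sum>t. w 0 ^ Suc t * exit_cdf (Suc n) (shift w) 0 t) \<le> (\<Sum>t. w 0 ^ Suc t * exit_cdf n (shift w) 0 t)"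
    using b exit_cdf_bounds[of "shift w"] w
    by (intro suminf_le summable_power_mult mult_left_mono exit_cdf_Suc_le) auto
  then show ?thesis unfolding mean_drift_def using b by (intro add_left_mono mult_left_mono) auto
qed

lemma mean_drift_tendsto:
  assumes w: "cookie_env w"
  shows "(\<lambda>n. mean_drift n w) \<longlonglongrightarrow> limit_drift w"
proof -
  note b = cookie_envD[OF w, of 0]
  have "(\<lambda>n. \<Sum>t. w 0 ^ Suc t * exit_cdf n (shift w) 0 t) \<longlonglongrightarrow> (\<Sum>t. w 0 ^ Suc t * escape (shift w) t)"
  proof (rule tannerys_theorem[THEN conjunct2, THEN conjunct2])
    show "(\<lambda>n. w 0 ^ Suc t * exit_cdf n (shift w) 0 t) \<longlonglongrightarrow> w 0 ^ Suc t * escape (shift w) t" for t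
      using w by (intro tendsto_intros escape_tendsto) simp
    show "\<forall>\<^sub>F (t, n) in at_top \<times>\<^sub>F sequentially. norm (w 0 ^ Suc t * exit_cdf n (shift w) 0 t) \<le> w 0 ^ Suc t"
      using b exit_cdf_bounds[of "shift w"] w
      by (intro always_eventually) (auto simp: abs_mult mult_left_le simp del: power_Suc)
    show "summable (\<lambda>t. w 0 ^ Suc t)" using power_Suc_sums[OF b(3,2)] by (rule sums_summable)
  qed simp
  then show ?thesis unfolding mean_drift_def limit_drift_def by (intro tendsto_intros)
qed

lemma limit_drift_le: "cookie_env w \<Longrightarrow> limit_drift w \<le> mean_drift n w"
  by (rule decseq_ge[OF decseq_SucI mean_drift_tendsto]) (auto intro: mean_drift_decseq)

lemma limit_drift_recurrent:
  assumes "cookie_env w" "escape w 0 = 0"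
  shows "limit_drift w = 2 - w 0 / (1 - w 0)"
  using escape_0_imp_shift[OF assms] by (simp add: limit_drift_def)

lemma limit_drift_ge:
  assumes "cookie_env w"
  shows "2 - w 0 / (1 - w 0) \<le> limit_drift w"
  using cookie_envD[OF assms, of 0] escape_bounds[of "shift w"] assms
  by (auto simp: limit_drift_def intro!: mult_nonneg_nonneg suminf_nonneg summable_power_mult
      simp del: power_Suc)

text \<open>\<open>escape (shift w) 0\<close> is positive too, so the series is positive, and a
  genuine cookie makes its factor positive. This strictness settles the critical case of mean
  exactly 2.\<close>

lemma limit_drift_gt:
  assumes w: "cookie_env w" and pos: "escape w 0 \<noteq> 0" and "w 0 > 1 / 2"
  shows "2 - w 0 / (1 - w 0) < limit_drift w"
proof -
  note b = cookie_envD[OF w, of 0]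
  have e: "0 \<le> escape (shift w) t \<and> escape (shift w) t \<le> 1" for t
    using escape_bounds[of "shift w"] w by simp
  have "escape (shift w) 0 \<noteq> 0" using pos escape_shift_0_iff[OF w] by simp
  with e[of 0] have "0 < w 0 ^ Suc 0 * escape (shift w) 0" using b by simp
  with e b have "0 < (\<Sum>t. w 0 ^ Suc t * escape (shift w) t)"
    by (intro suminf_pos2[of _ 0] summable_power_mult) (auto simp del: power_Suc)
  with assms(3) show ?thesis by (simp add: limit_drift_def del: power_Suc)
qed

section \<open>Averaging over the environment\<close>

lemma space_env_space [simp]: "space env_space = UNIV"
  by (simp add: env_space_def space_PiM)

lemma measurable_shift [measurable]: "shift \<in> measurable env_space env_space"
  unfolding env_space_def shift_def
  by (rule measurable_PiM_single') (auto intro: measurable_component_singleton simp: space_PiM)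

lemma measurable_env_component [measurable]: "(\<lambda>w. w x) \<in> borel_measurable env_space"
  unfolding env_space_def by (rule measurable_component_singleton) simp

lemma borel_measurable_left_cdf [measurable]:
  "f \<in> borel_measurable M \<Longrightarrow> (\<lambda>x. left_cdf (f x) t K) \<in> borel_measurable M"
proof (induction t arbitrary: K f)
  case (Suc t)
  note IH = Suc
  show ?case using Suc.prems
  proof (induction K arbitrary: f)
    case 0
    then show ?case using IH(1)[of f 0] by simp
  next
    case (Suc K)
    have [measurable]: "(\<lambda>x. left_cdf (f x) t (Suc K)) \<in> borel_measurable M"
      "(\<lambda>x. left_cdf (1 / 2) (Suc t) K) \<in> borel_measurable M" "f \<in> borel_measurable M"
      using IH(1)[OF Suc.prems] Suc by auto
    show ?case unfolding left_cdf.simps(3) by measurable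
  qed
qed simp

lemma borel_measurable_exit_cdf [measurable]:
  "(\<lambda>w. exit_cdf n w y K) \<in> borel_measurable env_space"
proof (induction n arbitrary: y K)
  case (Suc n)
  have [measurable]: "(\<lambda>w. exit_cdf n (shift w) (y - 1) t) \<in> borel_measurable env_space" for t
    by (rule measurable_compose[OF measurable_shift Suc])
  show ?case unfolding exit_cdf.simps(2) left_dif_def by measurable
qed simp

lemma borel_measurable_escape [measurable]: "(\<lambda>w. escape w K) \<in> borel_measurable env_space"
  unfolding escape_def by measurable

lemma borel_measurable_mean_left [measurable]: "mean_left n \<in> borel_measurable env_space"
  unfolding mean_left_def[abs_def] left_tail_def by measurable

lemma borel_measurable_mean_drift [measurable]: "mean_drift n \<in> borel_measurable env_space"
proof -
  have [measurable]: "(\<lambda>w. exit_cdf n (shift w) y t) \<in> borel_measurable env_space" for y t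
    by (rule measurable_compose[OF measurable_shift borel_measurable_exit_cdf])
  show ?thesis unfolding mean_drift_def[abs_def] by measurable
qed

lemma borel_measurable_limit_drift [measurable]: "limit_drift \<in> borel_measurable env_space"
proof -
  have [measurable]: "(\<lambda>w. escape (shift w) t) \<in> borel_measurable env_space" for t
    by (rule measurable_compose[OF measurable_shift borel_measurable_escape])
  show ?thesis unfolding limit_drift_def[abs_def] by measurable
qed

lemma sets_cookie_env [measurable]: "Measurable.pred env_space cookie_env"
  unfolding cookie_env_def[abs_def] by measurable

section \<open>Expectations under a stationary law\<close>

locale stationary_cookie_law = prob_space P for P :: "(int \<Rightarrow> real) measure" +
  assumes sets_P [measurable_cong]: "sets P = sets env_space"
    and invariant: "distr P env_space shift = P"
    and cookie: "AE w in P. cookie_env w"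
begin

lemma space_P [simp]: "space P = UNIV"
  using sets_eq_imp_space_eq[OF sets_P] by simp

lemma prob_UNIV [simp]: "prob UNIV = 1"
  using prob_space by simp

lemma integral_shift:
  fixes f :: "(int \<Rightarrow> real) \<Rightarrow> real"
  assumes "f \<in> borel_measurable env_space"
  shows "(\<integral>w. f (shift w) \<partial>P) = (\<integral>w. f w \<partial>P)"
  using integral_distr[of shift P env_space f] assms invariant by simp

lemma integrable_shift:
  fixes f :: "(int \<Rightarrow> real) \<Rightarrow> real"
  assumes "f \<in> borel_measurable env_space" "integrable P f"
  shows "integrable P (\<lambda>w. f (shift w))"
  using integrable_distr_eq[of shift P env_space f] assms invariant by simp

lemma integrable_mean_left: "integrable P (mean_left n)"
proof (rule integrable_const_bound[of _ "real n"])
  show "AE w in P. norm (mean_left n w) \<le> real n"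
    using cookie by eventually_elim (use mean_left_nonneg mean_left_le in auto)
qed measurable

lemma AE_mean_drift_eq: "AE w in P. mean_drift n w = mean_left (Suc n) w - mean_left n (shift w)"
  using cookie by eventually_elim (simp add: mean_left_Suc)

text \<open>The formula contains \<open>nu\<close>, whose mean may be infinite, but the drift is
  almost everywhere a difference of two bounded means.\<close>

lemma integrable_mean_drift: "integrable P (mean_drift n)"
proof -
  have "integrable P (\<lambda>w. mean_left (Suc n) w - mean_left n (shift w))"
    by (intro Bochner_Integration.integrable_diff integrable_mean_left integrable_shift) measurable
  then show ?thesis
    by (subst integrable_cong_AE[OF _ _ AE_mean_drift_eq]) measurable
qed

lemma integral_mean_left_Suc:
  "(\<integral>w. mean_left (Suc n) w \<partial>P) = (\<integral>w. mean_left n w \<partial>P) + (\<integral>w. mean_drift n w \<partial>P)"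
proof -
  have "(\<integral>w. mean_drift n w \<partial>P) = (\<integral>w. mean_left (Suc n) w - mean_left n (shift w) \<partial>P)"
    by (intro integral_cong_AE AE_mean_drift_eq) measurable
  also have "\<dots> = (\<integral>w. mean_left (Suc n) w \<partial>P) - (\<integral>w. mean_left n (shift w) \<partial>P)"
    by (intro Bochner_Integration.integral_diff integrable_mean_left integrable_shift) measurable
  finally show ?thesis using integral_shift[of "mean_left n"] by simp
qed

lemma integral_mean_left_nonneg: "0 \<le> (\<integral>w. mean_left n w \<partial>P)"
  by (intro integral_nonneg_AE) (use cookie mean_left_nonneg in \<open>auto elim!: eventually_mono\<close>)

text \<open>The averaged drifts decrease in \<open>n\<close>, so one negative value would bound all
  later ones away from 0 and force linear decay of a nonnegative quantity.\<close>

lemma integral_mean_drift_nonneg: "0 \<le> (\<integral>w. mean_drift n w \<partial>P)"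
proof (rule ccontr)
  let ?d = "\<lambda>n. \<integral>w. mean_drift n w \<partial>P" and ?e = "\<lambda>n. \<integral>w. mean_left n w \<partial>P"
  assume neg: "\<not> 0 \<le> ?d n"
  have "?d (Suc m) \<le> ?d m" for m
    by (intro integral_mono_AE integrable_mean_drift)
      (use cookie mean_drift_decseq in \<open>auto elim!: eventually_mono\<close>)
  then have mono: "?d m \<le> ?d n" if "n \<le> m" for m
    using lift_Suc_antimono_le[of ?d n m] that by blast
  have bound: "?e (n + k) \<le> ?e n + real k * ?d n" for k
  proof (induction k)
    case (Suc k)
    then show ?case using integral_mean_left_Suc[of "n + k"] mono[of "n + k"]
      by (simp add: algebra_simps)
  qed simp
  obtain k :: nat where "?e n / (- ?d n) < real k" using reals_Archimedean2 by blast
  with neg have "?e n + real k * ?d n < 0" by (simp add: field_simps)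
  with bound[of k] integral_mean_left_nonneg[of "n + k"] show False by simp
qed

text \<open>Fatou's lemma is applied to \<open>1 - mean_drift n\<close>, which is nonnegative, has
  integral at most 1 and tends to \<open>nu - 1\<close>. Integrability of \<open>nu\<close> thus
  comes out as a result.\<close>

lemma recurrent_imp_le_2:
  assumes rec: "AE w in P. escape w 0 = 0"
  shows "(\<integral>\<^sup>+ w. ennreal (w 0 / (1 - w 0)) \<partial>P) \<le> 2"
proof -
  have le1: "(\<integral>\<^sup>+ w. ennreal (1 - mean_drift n w) \<partial>P) \<le> 1" for n
  proof -
    have "(\<integral>\<^sup>+ w. ennreal (1 - mean_drift n w) \<partial>P) = ennreal (\<integral>w. 1 - mean_drift n w \<partial>P)"
      by (intro nn_integral_eq_integral Bochner_Integration.integrable_diff integrable_mean_drift)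
        (use cookie mean_drift_le_1 in \<open>auto elim!: eventually_mono\<close>)
    also have "(\<integral>w. 1 - mean_drift n w \<partial>P) = 1 - (\<integral>w. mean_drift n w \<partial>P)"
      by (simp add: Bochner_Integration.integral_diff integrable_mean_drift prob_space)
    finally show ?thesis using integral_mean_drift_nonneg[of n] ennreal_leI[of _ 1] by simp
  qed
  have "(\<integral>\<^sup>+ w. ennreal (w 0 / (1 - w 0) - 1) \<partial>P)
      = (\<integral>\<^sup>+ w. liminf (\<lambda>n. ennreal (1 - mean_drift n w)) \<partial>P)"
  proof (rule nn_integral_cong_AE)
    show "AE w in P. ennreal (w 0 / (1 - w 0) - 1) = liminf (\<lambda>n. ennreal (1 - mean_drift n w))"
      using cookie rec
    proof eventually_elim
      case (elim w)
      have "(\<lambda>n. ennreal (1 - mean_drift n w)) \<longlonglongrightarrow> ennreal (1 - limit_drift w)"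
        by (intro tendsto_ennrealI tendsto_intros mean_drift_tendsto elim)
      then have "liminf (\<lambda>n. ennreal (1 - mean_drift n w)) = ennreal (1 - limit_drift w)"
        by (intro lim_imp_Liminf) auto
      with limit_drift_recurrent[OF elim] show ?case by simp
    qed
  qed
  also have "\<dots> \<le> liminf (\<lambda>n. \<integral>\<^sup>+ w. ennreal (1 - mean_drift n w) \<partial>P)"
    by (rule nn_integral_liminf) measurable
  also have "\<dots> \<le> 1" using le1 by (intro Liminf_le) auto
  finally have le: "(\<integral>\<^sup>+ w. ennreal (w 0 / (1 - w 0) - 1) \<partial>P) \<le> 1" .
  have "(\<integral>\<^sup>+ w. ennreal (w 0 / (1 - w 0)) \<partial>P) = (\<integral>\<^sup>+ w. ennreal (w 0 / (1 - w 0) - 1) + 1 \<partial>P)"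
  proof (rule nn_integral_cong_AE)
    show "AE w in P. ennreal (w 0 / (1 - w 0)) = ennreal (w 0 / (1 - w 0) - 1) + 1"
      using cookie
    proof eventually_elim
      case (elim w)
      have "0 \<le> w 0 / (1 - w 0) - 1" using cookie_envD[OF elim, of 0] by (simp add: field_simps)
      then show ?case by (simp add: ennreal_plus[symmetric] flip: ennreal_1)
    qed
  qed
  also have "\<dots> = (\<integral>\<^sup>+ w. ennreal (w 0 / (1 - w 0) - 1) \<partial>P) + (\<integral>\<^sup>+ w. 1 \<partial>P)"
    by (rule nn_integral_add) measurable
  also have "\<dots> \<le> 1 + 1" using le by (intro add_mono) (auto simp: emeasure_eq_measure)
  finally show ?thesis by simp
qed

lemma transient_imp_gt_2:
  assumes trans: "AE w in P. escape w 0 \<noteq> 0"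
  shows "2 < (\<integral>\<^sup>+ w. ennreal (w 0 / (1 - w 0)) \<partial>P)"
proof (rule ccontr)
  let ?r = "\<lambda>w. w 0 / (1 - w 0) :: real"
  assume "\<not> ?thesis"
  then have le2: "(\<integral>\<^sup>+ w. ennreal (?r w) \<partial>P) \<le> 2" by simp
  have r0: "AE w in P. 0 \<le> ?r w"
    using cookie by eventually_elim (simp add: cookie_envD less_imp_le)
  have int_r: "integrable P ?r"
    using le2 r0 by (intro integrableI_nonneg) (auto intro: le_less_trans)
  have r_le: "(\<integral>w. ?r w \<partial>P) \<le> 2"
    using le2 nn_integral_eq_integral[OF int_r r0] by (simp flip: ennreal_numeral)
  have int_l: "integrable P limit_drift"
  proof (rule Bochner_Integration.integrable_bound[of _ "\<lambda>w. 2 + ?r w"])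
    show "AE w in P. norm (limit_drift w) \<le> norm (2 + ?r w)"
      using cookie r0
    proof eventually_elim
      case (elim w)
      with limit_drift_ge[of w] limit_drift_le[of w 0] mean_drift_le_1[of w 0] show ?case by auto
    qed
  qed (use int_r in auto)
  define c where "c = (\<integral>w. limit_drift w \<partial>P)"
  \<comment> \<open>\<open>limit_drift\<close> dominates \<open>2 - nu\<close>, whose mean is
    nonnegative. Without a positive mean the two would agree almost everywhere and \<open>nu\<close>
    would have mean 2; but agreement forces \<open>w 0 = 1 / 2\<close>, hence
    \<open>nu = 1\<close>.\<close>
  have c: "0 < c"
  proof (rule ccontr)
    assume neg: "\<not> 0 < c"
    let ?f = "\<lambda>w. limit_drift w - (2 - ?r w)"
    have f0: "AE w in P. 0 \<le> ?f w" using cookie limit_drift_ge by (auto elim!: eventually_mono)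
    have int_f: "integrable P ?f" using int_l int_r by simp
    have "(\<integral>w. ?f w \<partial>P) = c - (2 - (\<integral>w. ?r w \<partial>P))"
      using int_l int_r by (simp add: c_def prob_space)
    moreover have "0 \<le> (\<integral>w. ?f w \<partial>P)" using f0 by (rule integral_nonneg_AE)
    ultimately have "(\<integral>w. ?f w \<partial>P) = 0" and r2: "(\<integral>w. ?r w \<partial>P) = 2" using neg r_le by linarith+
    with f0 int_f have "AE w in P. ?f w = 0" using integral_nonneg_eq_0_iff_AE by blast
    then have "AE w in P. ?r w = 1"
      using cookie trans
    proof eventually_elim
      case (elim w)
      then have "w 0 = 1 / 2"
        using limit_drift_gt[of w] cookie_envD(1)[of w 0] by force
      then show ?case by simp
    qed
    then have "(\<integral>w. ?r w \<partial>P) = (\<integral>w. 1 \<partial>P)" by (intro integral_cong_AE) auto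
    with r2 show False by (simp add: prob_space)
  qed
  have lower: "c * real n \<le> (\<integral>w. mean_left n w \<partial>P)" for n
  proof (induction n)
    case (Suc n)
    have "c \<le> (\<integral>w. mean_drift n w \<partial>P)" unfolding c_def
      by (intro integral_mono_AE int_l integrable_mean_drift)
        (use cookie limit_drift_le in \<open>auto elim!: eventually_mono\<close>)
    with Suc show ?case by (simp add: integral_mean_left_Suc algebra_simps)
  qed simp
  have int_e: "integrable P (\<lambda>w. 1 - escape w A)" for A
    by (rule integrable_const_bound[of _ 1])
      (use cookie escape_bounds in \<open>auto elim!: eventually_mono\<close>)
  define q where "q A = (\<integral>w. 1 - escape w A \<partial>P)" for A
  have "q \<longlonglongrightarrow> (\<integral>w. 0 \<partial>P)" unfolding q_def
  proof (rule integral_dominated_convergence[where w = "\<lambda>_. 1"])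
    show "AE w in P. (\<lambda>A. 1 - escape w A) \<longlonglongrightarrow> 0"
      using cookie trans
    proof eventually_elim
      case (elim w)
      from tendsto_diff[OF tendsto_const[of 1] escape_tendsto_1[OF elim]] show ?case by simp
    qed
    show "AE w in P. norm (1 - escape w A) \<le> 1" for A
      using cookie escape_bounds by (auto elim!: eventually_mono)
  qed auto
  then have q: "q \<longlonglongrightarrow> 0" by simp
  \<comment> \<open>\<open>B\<close> pushes the second-moment term below \<open>c * n / 4\<close>.
    Only then is \<open>A\<close> chosen, because the middle term carries the factor
    \<open>B\<close>. Together they stay below half of the growth \<open>c * n\<close>.\<close>
  obtain B :: nat where "12 / c < real B" using reals_Archimedean2 by blast
  moreover have "0 < 12 / c" using c by simp
  ultimately have B0: "B > 0" by (auto intro: Nat.gr0I)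
  with \<open>12 / c < real B\<close> c have "3 / real B < c / 4" by (simp add: field_simps)
  note B = B0 this
  have "(\<lambda>A. real B * q A) \<longlonglongrightarrow> real B * 0" by (intro tendsto_intros q)
  then have "\<forall>\<^sub>F A in sequentially. real B * q A < c / 4"
    using c by (intro order_tendstoD(2)[of _ "real B * 0"]) auto
  then obtain A where A: "real B * q A < c / 4" by (auto simp: eventually_sequentially)
  have upper: "(\<integral>w. mean_left n w \<partial>P) \<le> real A + real n * (c / 2)" if n: "n > 0" for n
  proof -
    have "(\<integral>w. mean_left n w \<partial>P)
        \<le> (\<integral>w. (real A + 3 * real n / real B) + real (B * n) * (1 - escape w A) \<partial>P)"
    proof (intro integral_mono_AE integrable_mean_left)
      show "AE w in P. mean_left n w
          \<le> (real A + 3 * real n / real B) + real (B * n) * (1 - escape w A)"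
        using cookie
      proof eventually_elim
        case (elim w)
        from mean_left_le_escape[OF this n B(1), of A] show ?case by linarith
      qed
    qed (use int_e in auto)
    also have "\<dots> = real A + 3 * real n / real B + real (B * n) * q A"
      using int_e by (simp add: q_def prob_space)
    also have "\<dots> = real A + real n * (3 / real B + real B * q A)" by (simp add: field_simps)
    also have "\<dots> \<le> real A + real n * (c / 2)"
      using A B(2) by (intro add_left_mono mult_left_mono) auto
    finally show ?thesis .
  qed
  obtain n :: nat where n: "2 * real A / c < real n" using reals_Archimedean2 by blast
  moreover have "0 \<le> 2 * real A / c" using c by simp
  ultimately have n0: "n > 0" by (auto intro: Nat.gr0I)
  from n c have "real A < c * real n / 2" by (simp add: field_simps)
  with lower[of n] upper[OF n0] show False by (simp add: field_simps)
qed

section \<open>Consequences of ergodicity\<close>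

lemma measure_shift_vimage:
  assumes "B \<in> sets env_space"
  shows "measure P ((shift ^^ n) -` B) = measure P B \<and> (shift ^^ n) -` B \<in> sets env_space"
proof (induction n)
  case (Suc n)
  let ?C = "(shift ^^ n) -` B"
  have C: "?C \<in> sets env_space" using Suc by simp
  have e: "(shift ^^ Suc n) -` B = shift -` ?C \<inter> space P"
    by (simp add: vimage_comp[symmetric] funpow_Suc_right del: funpow.simps)
  have "measure P ?C = measure (distr P env_space shift) ?C" by (simp add: invariant)
  also have "\<dots> = measure P (shift -` ?C \<inter> space P)" using C by (intro measure_distr) measurable
  finally have "measure P ((shift ^^ Suc n) -` B) = measure P B" using Suc unfolding e by simp
  moreover have "shift -` ?C \<inter> space env_space \<in> sets env_space"
    by (rule measurable_sets[OF measurable_shift C])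
  ultimately show ?case unfolding e by simp
qed (use assms in simp)

text \<open>Poincare recurrence for the event that the escape probability exceeds \<open>c\<close>.\<close>

lemma escape_infinitely_often:
  assumes erg: "ergodic_law P" and trans: "AE w in P. escape w 0 \<noteq> 0"
  shows "\<exists>c>0. AE w in P. \<forall>m. \<exists>n\<ge>m. c \<le> escape ((shift ^^ n) w) 0"
proof -
  define B where "B c = {w. c \<le> escape w 0}" for c
  have B[measurable]: "B c \<in> sets env_space" for c
  proof -
    have "{w \<in> space env_space. c \<le> escape w 0} \<in> sets env_space" by measurable
    then show ?thesis by (simp add: B_def)
  qed
  have "\<exists>k. measure P (B (1 / real (Suc k))) \<noteq> 0"
  proof (rule ccontr)
    assume "\<nexists>k. measure P (B (1 / real (Suc k))) \<noteq> 0"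
    then have "B (1 / real (Suc k)) \<in> null_sets P" for k
      using B sets_P by (auto simp: null_sets_def emeasure_eq_measure)
    then have "AE w in P. w \<notin> B (1 / real (Suc k))" for k by (rule AE_not_in)
    then have "AE w in P. \<forall>k. w \<notin> B (1 / real (Suc k))" by (simp add: AE_all_countable)
    with trans cookie have "AE w in P. False"
    proof eventually_elim
      case (elim w)
      then have "0 < escape w 0" using escape_bounds[of w 0] by auto
      then obtain k where "1 / real (Suc k) < escape w 0" using nat_approx_posE by blast
      with elim(3) show False by (auto simp: B_def dest: spec[of _ k])
    qed
    then show False by simp
  qed
  then obtain k where k: "measure P (B (1 / real (Suc k))) \<noteq> 0" by blast
  define c where "c = 1 / real (Suc k)"
  have c: "c > 0" by (simp add: c_def)
  \<comment> \<open>\<open>U m\<close> contains a preimage of \<open>B c\<close>, so by invariance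
    its measure is at least that of \<open>B c\<close>. The same holds for the limit
    \<open>S\<close>, the event of infinitely many returns, which is exactly
    shift-invariant.\<close>
  define U where "U m = (\<Union>n\<in>{m..}. (shift ^^ n) -` B c)" for m
  define S where "S = (\<Inter>m. U m)"
  have vim: "(shift ^^ n) -` B c \<in> sets P" for n using measure_shift_vimage[OF B] sets_P by simp
  have U: "U m \<in> sets P" for m unfolding U_def using vim by auto
  then have S: "S \<in> sets P" unfolding S_def by auto
  have U_Suc: "U (Suc m) \<subseteq> U m" for m unfolding U_def by (intro UN_mono) auto
  have "measure P (B c) \<le> measure P (U m)" for m
  proof -
    have "measure P (B c) = measure P ((shift ^^ m) -` B c)" using measure_shift_vimage[OF B] by simp
    also have "\<dots> \<le> measure P (U m)" by (intro finite_measure_mono U) (auto simp: U_def)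
    finally show ?thesis .
  qed
  moreover have "(\<lambda>m. measure P (U m)) \<longlonglongrightarrow> measure P S" unfolding S_def
    using U decseq_SucI[of U] U_Suc by (intro finite_Lim_measure_decseq) auto
  ultimately have "measure P (B c) \<le> measure P S" by (intro LIMSEQ_le_const) auto
  with k have "measure P S \<noteq> 0" unfolding c_def using measure_nonneg[of P] by (metis antisym)
  moreover have "shift -` S \<inter> space P = S"
  proof -
    have "shift w \<in> U m \<longleftrightarrow> w \<in> U (Suc m)" for w m
    proof
      assume "shift w \<in> U m"
      then obtain n where "n \<ge> m" "(shift ^^ n) (shift w) \<in> B c" by (auto simp: U_def)
      then have "Suc n \<ge> Suc m" "(shift ^^ Suc n) w \<in> B c" by (simp_all add: funpow_swap1)
      then show "w \<in> U (Suc m)" unfolding U_def by blast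
    next
      assume "w \<in> U (Suc m)"
      then obtain n where n: "n \<ge> Suc m" "(shift ^^ n) w \<in> B c" by (auto simp: U_def)
      then obtain n' where "n = Suc n'" by (cases n) auto
      with n have "n' \<ge> m" "(shift ^^ n') (shift w) \<in> B c" by (simp_all add: funpow_swap1)
      then show "shift w \<in> U m" unfolding U_def by blast
    qed
    with U_Suc show ?thesis unfolding S_def by auto blast
  qed
  ultimately have "measure P S = 1" using erg S unfolding ergodic_law_def by blast
  then have "AE w in P. w \<in> S" using S by (simp add: AE_in_set_eq_1)
  then have "AE w in P. \<forall>m. \<exists>n\<ge>m. c \<le> escape ((shift ^^ n) w) 0"
    by eventually_elim (auto simp: S_def U_def B_def)
  with c show ?thesis by blast
qed

text \<open>\<open>ergodic_law\<close> speaks of sets equal to their preimage. Vanishing of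
  \<open>escape\<close> is shift-invariant for cookie environments, so \<open>R\<close> includes
  that condition, which is itself invariant because sites range over all integers.\<close>

lemma escape_dichotomy:
  assumes erg: "ergodic_law P"
  shows "(AE w in P. escape w 0 = 0) \<or> (AE w in P. escape w 0 \<noteq> 0)"
proof -
  define R where "R = {w. cookie_env w \<and> escape w 0 = 0}"
  have R: "R \<in> sets P"
  proof -
    have "{w \<in> space env_space. cookie_env w \<and> escape w 0 = 0} \<in> sets env_space" by measurable
    then show ?thesis by (simp add: sets_P R_def)
  qed
  have ce: "cookie_env (shift w) \<longleftrightarrow> cookie_env w" for w
  proof
    assume s: "cookie_env (shift w)"
    show "cookie_env w" unfolding cookie_env_def
    proof
      fix x
      from s[unfolded cookie_env_def, rule_format, of "x - 1"]
      show "1 / 2 \<le> w x \<and> w x < 1" by (simp add: shift_def)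
    qed
  qed simp
  have "shift -` R \<inter> space P = R" unfolding R_def using ce escape_shift_0_iff by auto
  with erg R consider "measure P R = 0" | "measure P R = 1" unfolding ergodic_law_def by blast
  then show ?thesis
  proof cases
    case 1
    then have "AE w in P. w \<notin> R"
      using R by (intro AE_not_in) (auto simp: null_sets_def emeasure_eq_measure)
    with cookie show ?thesis by (intro disjI2, eventually_elim) (auto simp: R_def)
  next
    case 2
    then have "AE w in P. w \<in> R" using R by (simp add: AE_in_set_eq_1)
    then show ?thesis by (intro disjI1, eventually_elim) (auto simp: R_def)
  qed
qed

end

section \<open>The walk after its first step\<close>

abbreviation paths :: "(nat \<Rightarrow> int) measure" where
  "paths \<equiv> \<Pi>\<^sub>M n\<in>UNIV. count_space UNIV"

lemma space_paths [simp]: "space paths = UNIV"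
  by (simp add: space_PiM)

lemma UNIV_paths [simp]: "UNIV \<in> sets paths"
  using sets.top[of paths] by simp

declare sets_walk_law [measurable_cong]

lemma Compl_in_sets_paths: "A \<in> sets paths \<Longrightarrow> - A \<in> sets paths"
  using sets.compl_sets[of A paths] by (simp add: Compl_eq_Diff_UNIV)

lemma measurable_path_component [measurable]: "(\<lambda>X. X n) \<in> measurable paths (count_space UNIV)"
  by (rule measurable_component_singleton) simp

lemma measurable_path_cons [measurable]: "case_nat y \<in> measurable paths paths"
proof (rule measurable_PiM_single')
  show "(\<lambda>X. case_nat y X i) \<in> measurable paths (count_space UNIV)" for i
    by (cases i) simp_all
qed simp

lemma sets_path_cons: "B \<in> sets paths \<Longrightarrow> {X. case_nat y X \<in> B} \<in> sets paths"
  using measurable_sets[OF measurable_path_cons, of B y] by (simp add: vimage_def)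

section \<open>First-step decomposition, starting from cylinders\<close>

definition cylinder :: "nat \<Rightarrow> (nat \<Rightarrow> int) \<Rightarrow> (nat \<Rightarrow> int) set" where
  "cylinder n a = {X. \<forall>k<n. X k = a k}"

lemma sets_cylinder [measurable]: "cylinder n a \<in> sets paths"
proof -
  have "{X \<in> space paths. \<forall>k<n. X k = a k} \<in> sets paths" by measurable
  then show ?thesis by (simp add: cylinder_def)
qed

lemma cylinder_0 [simp]: "cylinder 0 a = UNIV"
  by (simp add: cylinder_def)

lemma measure_walk_law_UNIV [simp]: "measure (walk_law w y) UNIV = 1"
  using prob_space.prob_space[OF prob_space_walk_law] by (simp add: space_walk_law)

lemma measure_cylinder_Suc:
  "measure (walk_law w y) (cylinder (Suc n) a)
    = measure (walk_law w y) (cylinder n a) * measure (walk_kernel w y n a) {a n}"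
  using emeasure_walk_law_step[of w y n a] by (simp add: measure_def cylinder_def enn2real_mult)

lemma measure_cylinder_1: "measure (walk_law w y) (cylinder (Suc 0) a) = (if a 0 = y then 1 else 0)"
  unfolding measure_cylinder_Suc by (simp add: walk_kernel_def measure_pmf_single)

definition step_prob :: "real \<Rightarrow> int \<Rightarrow> int \<Rightarrow> real" where
  "step_prob r x z = (if z = x + 1 then r else if z = x - 1 then 1 - r else 0)"

lemma measure_walk_kernel_Suc:
  assumes "cookie_env w"
  shows "measure (walk_kernel w y (Suc m) a) {z} = step_prob (right_prob w a m) (a m) z"
proof -
  let ?r = "right_prob w a m"
  have r: "0 \<le> ?r" "?r \<le> 1" using cookie_envD[OF assms] by (auto simp: right_prob_def)
  have "(\<lambda>b. if b then a m + 1 else a m - 1) -` {z} = (if z = a m + 1 then {True} else {})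
      \<union> (if z = a m - 1 then {False} else {})"
    by (auto split: if_splits)
  then show ?thesis using r
    by (simp add: walk_kernel_def measure_pmf_single pmf_map step_prob_def)
qed

lemma measure_cylinder_start:
  assumes "a 0 \<noteq> y"
  shows "measure (walk_law w y) (cylinder (Suc n) a) = 0"
proof (induction n)
  case 0
  show ?case using assms by (simp only: measure_cylinder_1 if_False)
next
  case (Suc n)
  then show ?case by (simp add: measure_cylinder_Suc[of _ _ "Suc n"])
qed

text \<open>The memory of the walk enters only through \<open>jumped_left\<close>, and a used site
  behaves like a fresh one with right probability 1/2. So a left jump from \<open>y\<close> can be
  recorded in the environment, and the transition factors agree one by one.\<close>

lemma cylinder_first_step:
  assumes w: "cookie_env w" and a: "a 0 = y"
  shows "measure (walk_law w y) (cylinder (Suc n) a)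
    = w y * measure (walk_law w (y + 1)) (cylinder n (\<lambda>k. a (Suc k)))
      + (1 - w y) * measure (walk_law (w(y := 1 / 2)) (y - 1)) (cylinder n (\<lambda>k. a (Suc k)))"
proof (induction n)
  case 0
  show ?case using a by (simp only: measure_cylinder_1) simp
next
  case (Suc n)
  let ?a = "\<lambda>k. a (Suc k)" and ?w' = "w(y := 1 / 2)"
  show ?case
  proof (cases n)
    case 0
    have "\<not> jumped_left a 0" by (simp add: jumped_left_def)
    then have "measure (walk_law w y) (cylinder (Suc (Suc 0)) a) = step_prob (w y) y (a 1)"
      by (simp add: measure_cylinder_Suc[of _ _ "Suc 0"] measure_cylinder_1 measure_walk_kernel_Suc[OF w]
          right_prob_def a)
    then show ?thesis unfolding 0 measure_cylinder_1 by (auto simp: step_prob_def)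
  next
    case (Suc m)
    have L: "measure (walk_law v x) (cylinder (Suc (Suc k)) b)
        = measure (walk_law v x) (cylinder (Suc k) b) * step_prob (right_prob v b k) (b k) (b (Suc k))"
      if "cookie_env v" for v x k b
      by (simp add: measure_cylinder_Suc[of _ _ "Suc k"] measure_walk_kernel_Suc[OF that])
    consider "a 1 = y + 1" | "a 1 = y - 1" | "a 1 \<noteq> y + 1" "a 1 \<noteq> y - 1" by blast
    then show ?thesis
    proof cases
      case 1
      have "jumped_left a (Suc m) \<longleftrightarrow> jumped_left ?a m"
      proof
        assume "jumped_left a (Suc m)"
        then obtain k where k: "k < Suc m" "a k = a (Suc m)" "a (Suc k) = a (Suc m) - 1"
          by (auto simp: jumped_left_def)
        have "k \<noteq> 0"
        proof
          assume "k = 0"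
          with k(2,3) have "a (Suc 0) = a 0 - 1" by simp
          with 1 a show False by simp
        qed
        then obtain k' where "k = Suc k'" by (cases k) auto
        with k show "jumped_left ?a m" by (auto simp: jumped_left_def)
      qed (auto simp: jumped_left_def)
      then have r: "right_prob w a (Suc m) = right_prob w ?a m" by (simp add: right_prob_def)
      have z: "measure (walk_law ?w' (y - 1)) (cylinder (Suc k) ?a) = 0" for k
        using 1 by (intro measure_cylinder_start) simp
      show ?thesis
        unfolding Suc L[OF w, of y "Suc m" a] L[OF w, of "y + 1" m ?a] z using Suc.IH[unfolded Suc z] r by simp
    next
      case 2
      \<comment> \<open>The left jump at time 0 has marked \<open>y\<close>. For the shortened path
        this mark is carried by \<open>?w'\<close>, which gives 1/2 at \<open>y\<close> whatever the
        shortened path did there.\<close>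
      have "jumped_left a (Suc m) \<longleftrightarrow> a (Suc m) = y \<or> jumped_left ?a m"
      proof
        assume "jumped_left a (Suc m)"
        then obtain k where k: "k < Suc m" "a k = a (Suc m)" "a (Suc k) = a (Suc m) - 1"
          by (auto simp: jumped_left_def)
        then show "a (Suc m) = y \<or> jumped_left ?a m"
          using a by (cases k) (auto simp: jumped_left_def)
      next
        assume "a (Suc m) = y \<or> jumped_left ?a m"
        then show "jumped_left a (Suc m)"
          using a 2 by (auto simp: jumped_left_def)
      qed
      then have r: "right_prob w a (Suc m) = right_prob ?w' ?a m" by (auto simp: right_prob_def)
      have z: "measure (walk_law w (y + 1)) (cylinder (Suc k) ?a) = 0" for k
        using 2 by (intro measure_cylinder_start) simp
      show ?thesis
        unfolding Suc L[OF w, of y "Suc m" a] L[OF cookie_env_upd[OF w], of y "y - 1" m ?a] z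
        using Suc.IH[unfolded Suc z] r by (simp del: fun_upd_apply)
    next
      case 3
      have z: "measure (walk_law w (y + 1)) (cylinder (Suc k) ?a) = 0"
        "measure (walk_law ?w' (y - 1)) (cylinder (Suc k) ?a) = 0" for k
        using 3 by (intro measure_cylinder_start; simp)+
      show ?thesis
        unfolding Suc L[OF w, of y "Suc m" a] z using Suc.IH[unfolded Suc z] by simp
    qed
  qed
qed

text \<open>The empty set is added to close the family under intersections, as the Dynkin argument
  demands.\<close>

definition cylinders :: "(nat \<Rightarrow> int) set set" where
  "cylinders = insert {} {cylinder n a | n a. True}"

lemma Int_stable_cylinders: "Int_stable cylinders"
proof (rule Int_stableI)
  fix A B assume A: "A \<in> cylinders" and B: "B \<in> cylinders"
  show "A \<inter> B \<in> cylinders"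
  proof (cases "A \<inter> B = {}")
    case False
    then obtain X where X: "X \<in> A" "X \<in> B" by blast
    with A B obtain n a m b where "A = cylinder n a" "B = cylinder m b" by (auto simp: cylinders_def)
    with X have "A = cylinder n X" "B = cylinder m X" by (auto simp: cylinder_def)
    then have "A \<inter> B = cylinder (max n m) X"
      by (auto simp: cylinder_def less_max_iff_disj)
    then show ?thesis by (auto simp: cylinders_def)
  qed (simp add: cylinders_def)
qed

lemma sets_paths_cylinders: "sets paths \<subseteq> sigma_sets UNIV cylinders"
proof -
  interpret sigma_algebra UNIV "sigma_sets UNIV cylinders"
    by (rule sigma_algebra_sigma_sets) simp
  have "{X. X i \<in> A} \<in> sigma_sets UNIV cylinders" for i and A :: "int set"
  proof -
    have "{X. X i \<in> A} = (\<Union>l\<in>{l. length l = Suc i \<and> l ! i \<in> A}. cylinder (Suc i) (\<lambda>k. l ! k))"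
    proof (intro set_eqI iffI)
      fix X :: "nat \<Rightarrow> int" assume "X \<in> {X. X i \<in> A}"
      then have "map X [0..<Suc i] \<in> {l. length l = Suc i \<and> l ! i \<in> A}"
        "X \<in> cylinder (Suc i) (\<lambda>k. map X [0..<Suc i] ! k)"
        by (auto simp: cylinder_def nth_append simp del: upt_Suc)
      then show "X \<in> (\<Union>l\<in>{l. length l = Suc i \<and> l ! i \<in> A}. cylinder (Suc i) (\<lambda>k. l ! k))" by blast
    qed (auto simp: cylinder_def)
    also have "\<dots> \<in> sigma_sets UNIV cylinders"
      by (intro countable_UN'') (auto simp: cylinders_def)
    finally show ?thesis .
  qed
  then have "sigma_sets UNIV {{f \<in> \<Pi>\<^sub>E i\<in>UNIV. space (count_space UNIV). f i \<in> A} | i A.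
      i \<in> UNIV \<and> A \<in> sets (count_space (UNIV :: int set))} \<subseteq> sigma_sets UNIV cylinders"
    by (intro sigma_sets_mono) auto
  then show ?thesis by (simp add: sets_PiM_single)
qed

text \<open>Both sides are probability measures in \<open>B\<close> that agree on an
  intersection-stable generator.\<close>

lemma walk_first_step:
  assumes w: "cookie_env w" and B: "B \<in> sets paths"
  shows "measure (walk_law w y) B = w y * measure (walk_law w (y + 1)) {X. case_nat y X \<in> B}
    + (1 - w y) * measure (walk_law (w(y := 1 / 2)) (y - 1)) {X. case_nat y X \<in> B}"
proof -
  let ?eq = "\<lambda>B. measure (walk_law w y) B = w y * measure (walk_law w (y + 1)) {X. case_nat y X \<in> B}
    + (1 - w y) * measure (walk_law (w(y := 1 / 2)) (y - 1)) {X. case_nat y X \<in> B}"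
  have fin: "finite_measure (walk_law v x)" for v x
    using prob_space_walk_law by (rule prob_space.finite_measure)
  have measure_compl: "measure (walk_law v x) (- C) = 1 - measure (walk_law v x) C"
    if "C \<in> sets paths" for v x C
    using finite_measure.finite_measure_compl[OF fin, of C v x] that
    by (simp add: sets_walk_law space_walk_law Compl_eq_Diff_UNIV)
  have "cylinders \<subseteq> Pow UNIV" by simp
  from Int_stable_cylinders this subsetD[OF sets_paths_cylinders B]
  have "B \<in> sets paths \<and> ?eq B"
  proof (induction rule: sigma_sets_induct_disjoint)
    case (basic A)
    show ?case
    proof (cases "A = {}")
      case False
      with basic obtain n a where A: "A = cylinder n a" by (auto simp: cylinders_def)
      show ?thesis
      proof (cases n)
        case (Suc m)
        have e: "{X. case_nat y X \<in> A} = (if a 0 = y then cylinder m (\<lambda>k. a (Suc k)) else {})"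
          by (auto simp: A Suc cylinder_def less_Suc_eq_0_disj)
        show ?thesis unfolding e
          using cylinder_first_step[OF w, of a y m] measure_cylinder_start[of a y w m]
          by (simp add: A Suc del: fun_upd_apply)
      qed (simp add: A)
    qed simp
  next
    case (compl A)
    note A = conjunct1[OF compl(2)] and eq = conjunct2[OF compl(2)]
    have e: "{X. case_nat y X \<in> - A} = - {X. case_nat y X \<in> A}" by auto
    have "?eq (- A)"
      unfolding e measure_compl[OF A] measure_compl[OF sets_path_cons[OF A]] eq
      by (simp only: ring_distribs)
    with Compl_in_sets_paths[OF A] show ?case by (simp only: Compl_eq_Diff_UNIV)
  next
    case (union A)
    note A = conjunct1[OF union(3)] and eq = conjunct2[OF union(3)]
    have e: "{X. case_nat y X \<in> (\<Union>i. A i)} = (\<Union>i. {X. case_nat y X \<in> A i})" by auto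
    have d: "disjoint_family (\<lambda>i. {X. case_nat y X \<in> A i})"
      using union(1) unfolding disjoint_family_on_def by blast
    have s: "(\<lambda>i. measure (walk_law v x) (C i)) sums measure (walk_law v x) (\<Union>i. C i)"
      if "disjoint_family C" "\<And>i. C i \<in> sets paths" for C :: "nat \<Rightarrow> (nat \<Rightarrow> int) set" and v x
      using that by (intro finite_measure.finite_measure_UNION[OF fin]) (auto simp: sets_walk_law)
    have "(\<lambda>i. measure (walk_law w y) (A i)) sums
        (w y * measure (walk_law w (y + 1)) {X. case_nat y X \<in> (\<Union>i. A i)}
        + (1 - w y) * measure (walk_law (w(y := 1 / 2)) (y - 1)) {X. case_nat y X \<in> (\<Union>i. A i)})"
      unfolding e eq by (intro sums_add sums_mult s d sets_path_cons A)
    moreover have "(\<lambda>i. measure (walk_law w y) (A i)) sums measure (walk_law w y) (\<Union>i. A i)"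
      by (intro s union A)
    ultimately have "?eq (\<Union>i. A i)" by (rule sums_unique2[rotated])
    moreover have "(\<Union>i. A i) \<in> sets paths" using A by auto
    ultimately show ?case by (intro conjI)
  qed (simp_all)
  then show ?thesis ..
qed

section \<open>Hitting probabilities\<close>

definition hit :: "int \<Rightarrow> (nat \<Rightarrow> int) set" where
  "hit z = {X. \<exists>j. X j = z}"

definition hit_by :: "int \<Rightarrow> nat \<Rightarrow> (nat \<Rightarrow> int) set" where
  "hit_by z k = {X. \<exists>j\<le>k. X j = z}"

lemma sets_hit_by [measurable]: "hit_by z k \<in> sets paths"
proof -
  have "{X \<in> space paths. \<exists>j\<le>k. X j = z} \<in> sets paths" by measurable
  then show ?thesis by (simp add: hit_by_def)
qed

lemma sets_hit [measurable]: "hit z \<in> sets paths"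
proof -
  have "{X \<in> space paths. \<exists>j. X j = z} \<in> sets paths" by measurable
  then show ?thesis by (simp add: hit_def)
qed

lemma measure_le_1 [simp]: "measure (walk_law w y) A \<le> 1"
  by (rule prob_space.prob_le_1[OF prob_space_walk_law])

lemma walk_law_mono: "A \<subseteq> B \<Longrightarrow> B \<in> sets paths \<Longrightarrow> measure (walk_law w y) A \<le> measure (walk_law w y) B"
  by (intro finite_measure.finite_measure_mono prob_space.finite_measure[OF prob_space_walk_law])
    (simp_all add: sets_walk_law)

lemma walk_law_start_superset:
  assumes "{X. X 0 = y} \<subseteq> B" "B \<in> sets paths"
  shows "measure (walk_law w y) B = 1"
  using walk_law_mono[OF assms, of w y] walk_law_start[of w y] by (simp add: antisym)

lemma walk_law_compl: "A \<in> sets paths \<Longrightarrow> measure (walk_law w y) (- A) = 1 - measure (walk_law w y) A"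
  using prob_space.prob_compl[OF prob_space_walk_law, of A w y]
  by (simp add: sets_walk_law space_walk_law Compl_eq_Diff_UNIV)

lemma hit_by_self: "measure (walk_law w z) (hit_by z k) = 1"
  by (rule walk_law_start_superset[OF _ sets_hit_by]) (auto simp: hit_by_def)

lemma hit_self: "measure (walk_law w z) (hit z) = 1"
  by (rule walk_law_start_superset[OF _ sets_hit]) (auto simp: hit_def)

lemma hit_by_0:
  assumes "y \<noteq> z"
  shows "measure (walk_law w y) (hit_by z 0) = 0"
proof -
  have "measure (walk_law w y) (- hit_by z 0) = 1"
    using assms by (intro walk_law_start_superset Compl_in_sets_paths sets_hit_by) (auto simp: hit_by_def)
  then show ?thesis by (simp add: walk_law_compl)
qed

lemma hit_by_step:
  assumes "cookie_env w" "y \<noteq> z"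
  shows "measure (walk_law w y) (hit_by z (Suc k)) = w y * measure (walk_law w (y + 1)) (hit_by z k)
    + (1 - w y) * measure (walk_law (w(y := 1 / 2)) (y - 1)) (hit_by z k)"
proof -
  have "{X. case_nat y X \<in> hit_by z (Suc k)} = hit_by z k"
  proof (intro set_eqI iffI)
    fix X assume "X \<in> {X. case_nat y X \<in> hit_by z (Suc k)}"
    then obtain j where j: "j \<le> Suc k" "case_nat y X j = z" by (auto simp: hit_by_def)
    then show "X \<in> hit_by z k" using assms(2) by (cases j) (auto simp: hit_by_def)
  next
    fix X assume "X \<in> hit_by z k"
    then obtain j where "j \<le> k" "X j = z" by (auto simp: hit_by_def)
    then have "Suc j \<le> Suc k \<and> case_nat y X (Suc j) = z" by simp
    then show "X \<in> {X. case_nat y X \<in> hit_by z (Suc k)}" unfolding hit_by_def by blast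
  qed
  then show ?thesis using walk_first_step[OF assms(1) sets_hit_by] by metis
qed

lemma hit_step:
  assumes "cookie_env w" "y \<noteq> z"
  shows "measure (walk_law w y) (hit z) = w y * measure (walk_law w (y + 1)) (hit z)
    + (1 - w y) * measure (walk_law (w(y := 1 / 2)) (y - 1)) (hit z)"
proof -
  have "{X. case_nat y X \<in> hit z} = hit z"
  proof (intro set_eqI iffI)
    fix X assume "X \<in> {X. case_nat y X \<in> hit z}"
    then obtain j where "case_nat y X j = z" by (auto simp: hit_def)
    then show "X \<in> hit z" using assms(2) by (cases j) (auto simp: hit_def)
  next
    fix X assume "X \<in> hit z"
    then obtain j where "X j = z" by (auto simp: hit_def)
    then have "case_nat y X (Suc j) = z" by simp
    then show "X \<in> {X. case_nat y X \<in> hit z}" unfolding hit_def by blast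
  qed
  then show ?thesis using walk_first_step[OF assms(1) sets_hit] by metis
qed

lemma hit_by_tendsto:
  assumes "A \<in> sets paths"
  shows "(\<lambda>k. measure (walk_law w y) (A \<inter> hit_by z k)) \<longlonglongrightarrow> measure (walk_law w y) (A \<inter> hit z)"
proof -
  have "A \<inter> hit z = (\<Union>k. A \<inter> hit_by z k)" by (auto simp: hit_def hit_by_def)
  moreover have "(\<lambda>k. measure (walk_law w y) (A \<inter> hit_by z k)) \<longlonglongrightarrow> measure (walk_law w y) (\<Union>k. A \<inter> hit_by z k)"
    using assms by (intro finite_measure.finite_Lim_measure_incseq
        prob_space.finite_measure[OF prob_space_walk_law] incseq_SucI)
      (auto simp: sets_walk_law hit_by_def intro!: sets.Int sets_hit_by[unfolded hit_by_def] intro: le_SucI)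
  ultimately show ?thesis by simp
qed

text \<open>A maximum principle for pairs of environment and position. From anywhere in the strip at
  most \<open>b - a\<close> right steps in a row, each of probability at least 1/2, lead to
  \<open>b\<close>, so a common bound \<open>m\<close> improves to \<open>m * r\<close> with
  \<open>r < 1\<close>, and iteration sends it to 0.\<close>

lemma strip_maximum:
  fixes d :: "(int \<Rightarrow> real) \<Rightarrow> int \<Rightarrow> real"
  assumes le_M: "\<And>w y. cookie_env w \<Longrightarrow> d w y \<le> M"
    and a: "\<And>w. cookie_env w \<Longrightarrow> d w a \<le> 0" and b: "\<And>w. cookie_env w \<Longrightarrow> d w b \<le> 0"
    and sub: "\<And>w y. cookie_env w \<Longrightarrow> a < y \<Longrightarrow> y < b \<Longrightarrow>
      d w y \<le> w y * d w (y + 1) + (1 - w y) * d (w(y := 1 / 2)) (y - 1)"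
    and w: "cookie_env w" and y: "a \<le> y" "y \<le> b"
  shows "d w y \<le> 0"
proof -
  define L where "L = nat (b - a)"
  define r where "r = 1 - (1 / 2 :: real) ^ L"
  have r: "0 \<le> r" "r < 1" by (auto simp: r_def power_le_one)
  have contract: "d w y \<le> m * r"
    if m: "0 \<le> m" and le: "\<And>w y. cookie_env w \<Longrightarrow> a \<le> y \<Longrightarrow> y \<le> b \<Longrightarrow> d w y \<le> m"
      and w: "cookie_env w" and y: "a \<le> y" "y \<le> b" for m w y
  proof -
    have "d w y \<le> m * (1 - (1 / 2) ^ j)" if "cookie_env w" "a \<le> y" "y = b - int j" for j w y
      using that
    proof (induction j arbitrary: w y)
      case 0
      then show ?case using b by simp
    next
      case (Suc j)
      note e = cookie_envD[OF Suc.prems(1), of y]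
      show ?case
      proof (cases "y = a")
        case True
        have "0 \<le> m * (1 - (1 / 2) ^ Suc j)"
          using m by (intro mult_nonneg_nonneg) (auto simp: power_le_one simp del: power_Suc)
        with a[OF Suc.prems(1)] True show ?thesis by simp
      next
        case False
        then have "d w y \<le> w y * d w (y + 1) + (1 - w y) * d (w(y := 1 / 2)) (y - 1)"
          using Suc.prems by (intro sub) auto
        also have "\<dots> \<le> w y * (m * (1 - (1 / 2) ^ j)) + (1 - w y) * m"
          using Suc.prems False e
          by (intro add_mono mult_left_mono Suc.IH le) auto
        also have "\<dots> = m * (1 - w y * (1 / 2) ^ j)" by (simp add: algebra_simps)
        also have "\<dots> \<le> m * (1 - (1 / 2) ^ Suc j)"
          using m e by (intro mult_left_mono) auto
        finally show ?thesis .
      qed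
    qed
    from this[of w y "nat (b - y)"] w y have "d w y \<le> m * (1 - (1 / 2) ^ nat (b - y))" by simp
    also have "\<dots> \<le> m * r" unfolding r_def L_def
      using m y by (intro mult_left_mono diff_left_mono power_decreasing) auto
    finally show ?thesis .
  qed
  have iter: "d w y \<le> max M 0 * r ^ k" if "cookie_env w" "a \<le> y" "y \<le> b" for k w y
    using that
  proof (induction k arbitrary: w y)
    case 0
    then show ?case using le_M[of w y] by simp
  next
    case (Suc k)
    have "d w y \<le> max M 0 * r ^ k * r"
      using r by (intro contract Suc) auto
    then show ?case by (simp add: mult_ac)
  qed
  have "(\<lambda>k. max M 0 * r ^ k) \<longlonglongrightarrow> max M 0 * 0"
    using r by (intro tendsto_intros LIMSEQ_realpow_zero) auto
  then have "d w y \<le> max M 0 * 0" by (rule LIMSEQ_le_const) (use iter[OF w y] in auto)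
  then show ?thesis by simp
qed

text \<open>As \<open>w y \<ge> 1 / 2\<close>, the function \<open>1 - (z - y) / N\<close> is
  subharmonic left of \<open>z\<close>. It is 0 at \<open>z - N\<close> and 1 at \<open>z\<close>,
  so it lies below the hitting probability; let \<open>N\<close> tend to infinity.\<close>

lemma hit_right:
  assumes w: "cookie_env w" and "y \<le> z"
  shows "measure (walk_law w y) (hit z) = 1"
proof -
  have ge: "1 - real_of_int (z - y) / real N \<le> measure (walk_law w y) (hit z)"
    if N: "int N > z - y" "N > 0" for N
  proof -
    let ?a = "z - int N"
    \<comment> \<open>The absolute value keeps \<open>?d\<close> at most 1 to the right of
      \<open>z\<close> as well, since the maximum principle asks for a bound at all
      positions.\<close>
    let ?d = "\<lambda>w y. 1 - real_of_int \<bar>z - y\<bar> / real N - measure (walk_law w y) (hit z)"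
    have "?d w y \<le> 0"
    proof (rule strip_maximum[where d = ?d and a = ?a and b = z and M = 1])
      show "?d v x \<le> 1" for v x
        by (smt (verit) divide_nonneg_nonneg measure_nonneg of_int_0_le_iff of_nat_0_le_iff abs_ge_zero)
      show "?d v ?a \<le> 0" for v using N by simp
      show "?d v z \<le> 0" for v by (simp add: hit_self)
      show "?d v x \<le> v x * ?d v (x + 1) + (1 - v x) * ?d (v(x := 1 / 2)) (x - 1)"
        if v: "cookie_env v" and x: "?a < x" "x < z" for v x
      proof -
        note e = cookie_envD[OF v, of x]
        have 1: "v x * (1 - real_of_int \<bar>z - (x + 1)\<bar> / N) + (1 - v x) * (1 - real_of_int \<bar>z - (x - 1)\<bar> / N)
            = (1 - real_of_int \<bar>z - x\<bar> / N) + (2 * v x - 1) / N"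
        proof -
          have "real_of_int \<bar>z - (x + 1)\<bar> = real_of_int \<bar>z - x\<bar> - 1" "real_of_int \<bar>z - (x - 1)\<bar> = real_of_int \<bar>z - x\<bar> + 1"
            using x by linarith+
          then show ?thesis using N by (simp only:) (simp add: field_simps)
        qed
        have 2: "measure (walk_law v x) (hit z) = v x * measure (walk_law v (x + 1)) (hit z)
            + (1 - v x) * measure (walk_law (v(x := 1 / 2)) (x - 1)) (hit z)"
          using x by (intro hit_step v) simp
        have "0 \<le> (2 * v x - 1) / N" using e by simp
        then show ?thesis using 1 2 unfolding right_diff_distrib[of _ _ "measure _ _"] by linarith
      qed
    qed (use w N assms in auto)
    with assms show ?thesis by simp
  qed
  have "(\<lambda>N. 1 - real_of_int (z - y) / real N) \<longlonglongrightarrow> 1 - 0"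
    by (intro tendsto_intros real_tendsto_divide_at_top filterlim_real_sequentially)
  moreover have "\<forall>\<^sub>F N in sequentially. 1 - real_of_int (z - y) / real N \<le> measure (walk_law w y) (hit z)"
    using eventually_gt_at_top[of "nat (z - y)"] by eventually_elim (rule ge; use assms in linarith)
  ultimately have "1 - 0 \<le> measure (walk_law w y) (hit z)"
    by (intro tendsto_upperbound[of _ _ sequentially]) auto
  then show ?thesis by (simp add: antisym)
qed

section \<open>Leaving a strip and a half-line\<close>

definition translate :: "int \<Rightarrow> (int \<Rightarrow> real) \<Rightarrow> int \<Rightarrow> real" where
  "translate b w = (\<lambda>x. w (x + b))"

lemma cookie_env_translate [simp]: "cookie_env w \<Longrightarrow> cookie_env (translate b w)"
  by (simp add: cookie_env_def translate_def)

lemma translate_upd: "translate b (w(y := v)) = (translate b w)(y - b := v)"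
  by (auto simp: translate_def fun_eq_iff)

text \<open>The probability that the walk from \<open>y\<close> leaves the strip \<open>{b..<b + n}\<close> to the right.\<close>

definition exit_right :: "int \<Rightarrow> nat \<Rightarrow> (int \<Rightarrow> real) \<Rightarrow> int \<Rightarrow> real" where
  "exit_right b n w y = (if y < b then 0 else exit_cdf n (translate b w) (y - b) 0)"

lemma exit_right_bounds: "cookie_env w \<Longrightarrow> 0 \<le> exit_right b n w y \<and> exit_right b n w y \<le> 1"
  using exit_cdf_bounds[of "translate b w"] by (simp add: exit_right_def)

lemma exit_right_top: "cookie_env w \<Longrightarrow> exit_right b n w (b + int n) = 1"
  using exit_cdf_top[of "translate b w" n 0] by (simp add: exit_right_def)

lemma exit_right_step:
  assumes "cookie_env w" "b \<le> y" "y < b + int n"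
  shows "exit_right b n w y
    = w y * exit_right b n w (y + 1) + (1 - w y) * exit_right b n (w(y := 1 / 2)) (y - 1)"
proof (cases "y = b")
  case True
  moreover have "translate b w 0 = w b" by (simp add: translate_def)
  ultimately show ?thesis
    using exit_cdf_step_0[of "translate b w" n 0] assms by (simp add: exit_right_def)
next
  case False
  have "translate b w (y - b) = w y" by (simp add: translate_def)
  moreover have e: "y + 1 - b = y - b + 1" "y - 1 - b = y - b - 1" by simp_all
  ultimately show ?thesis
    using exit_cdf_step[of "translate b w" "y - b" n 0] assms False
    unfolding exit_right_def translate_upd e by (simp del: fun_upd_apply)
qed

text \<open>Exit to the right and a visit to \<open>b - 1\<close> obey the same first-step equation
  inside the strip, so the maximum principle shows that their probabilities add up to at least
  1.\<close>

lemma hit_left_ge: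
  assumes w: "cookie_env w"
  shows "1 - escape (translate b w) 0 \<le> measure (walk_law w b) (hit (b - 1))"
proof -
  have "1 - exit_cdf n (translate b w) 0 0 \<le> measure (walk_law w b) (hit (b - 1))" for n
  proof -
    let ?d = "\<lambda>w y. 1 - exit_right b n w y - measure (walk_law w y) (hit (b - 1))"
    have "?d w b \<le> 0"
    proof (rule strip_maximum[where d = ?d and a = "b - 1" and b = "b + int n" and M = 1])
      show "?d v x \<le> 1" if "cookie_env v" for v x
        using exit_right_bounds[OF that, of b n x] measure_nonneg[of "walk_law v x" "hit (b - 1)"] by linarith
      show "?d v (b - 1) \<le> 0" for v by (simp add: hit_self exit_right_def)
      show "?d v (b + int n) \<le> 0" if "cookie_env v" for v using exit_right_top[OF that] by simp
      show "?d v x \<le> v x * ?d v (x + 1) + (1 - v x) * ?d (v(x := 1 / 2)) (x - 1)"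
        if "cookie_env v" "b - 1 < x" "x < b + int n" for v x
        using exit_right_step[of v b x n] hit_step[of v x "b - 1"] that
        by (simp add: algebra_simps del: fun_upd_apply)
    qed (use w in auto)
    then show ?thesis by (simp add: exit_right_def)
  qed
  then show ?thesis
    by (intro LIMSEQ_le_const2[OF tendsto_diff[OF tendsto_const escape_tendsto]]) (use w in auto)
qed

text \<open>Within \<open>k\<close> steps the walk cannot pass \<open>b + n\<close>, so a visit to
  \<open>x < b\<close> requires an exit to the left. The finite horizon permits a plain induction on
  \<open>k\<close>.\<close>

lemma hit_by_left_le:
  "cookie_env w \<Longrightarrow> x < b \<Longrightarrow> b - 1 \<le> y \<Longrightarrow> y + int k \<le> b + int n \<Longrightarrow>
    measure (walk_law w y) (hit_by x k) \<le> 1 - exit_right b n w y"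
proof (induction k arbitrary: w y)
  case 0
  show ?case
  proof (cases "y < b")
    case False
    with 0 have "y \<noteq> x" by simp
    with exit_right_bounds[OF 0(1)] show ?thesis by (simp add: hit_by_0)
  qed (simp add: exit_right_def)
next
  case (Suc k)
  note e = cookie_envD[OF Suc.prems(1), of y]
  show ?case
  proof (cases "y < b")
    case False
    with Suc.prems have "measure (walk_law w y) (hit_by x (Suc k)) = w y * measure (walk_law w (y + 1)) (hit_by x k)
        + (1 - w y) * measure (walk_law (w(y := 1 / 2)) (y - 1)) (hit_by x k)"
      by (intro hit_by_step) auto
    also have "\<dots> \<le> w y * (1 - exit_right b n w (y + 1)) + (1 - w y) * (1 - exit_right b n (w(y := 1 / 2)) (y - 1))"
    proof -
      have "measure (walk_law w (y + 1)) (hit_by x k) \<le> 1 - exit_right b n w (y + 1)"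
        using Suc.prems False by (intro Suc.IH; linarith)
      moreover have "measure (walk_law (w(y := 1 / 2)) (y - 1)) (hit_by x k) \<le> 1 - exit_right b n (w(y := 1 / 2)) (y - 1)"
        using Suc.prems False by (intro Suc.IH cookie_env_upd; linarith)
      ultimately show ?thesis using e by (intro add_mono mult_left_mono) auto
    qed
    also have "\<dots> = 1 - exit_right b n w y"
      using exit_right_step[of w b y n] Suc.prems False by (simp add: algebra_simps del: fun_upd_apply)
    finally show ?thesis .
  qed (simp add: exit_right_def)
qed

lemma hit_left_le:
  assumes w: "cookie_env w" and x: "x < b"
  shows "measure (walk_law w b) (hit x) \<le> 1 - escape (translate b w) 0"
proof -
  have "measure (walk_law w b) (hit_by x k) \<le> 1 - escape (translate b w) 0" for k
    using hit_by_left_le[OF w x, of b k k] escape_le[of "translate b w" 0 k] w by (simp add: exit_right_def)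
  then show ?thesis
    using LIMSEQ_le_const2[OF hit_by_tendsto[OF UNIV_paths, of w b x]] by auto
qed

text \<open>One half of the strong Markov property at the hitting time of \<open>z\<close>; a state is
  a pair of the current environment and the current position.\<close>

lemma strong_markov_le:
  assumes D: "\<And>w y. (w, y) \<in> D \<Longrightarrow> cookie_env w"
    and closed: "\<And>w y. (w, y) \<in> D \<Longrightarrow> y \<noteq> z \<Longrightarrow> (w, y + 1) \<in> D \<and> (w(y := 1 / 2), y - 1) \<in> D"
    and A: "A \<in> sets paths" "\<And>y X. case_nat y X \<in> A \<Longrightarrow> X \<in> A"
    and s: "0 \<le> s" "\<And>w. (w, z) \<in> D \<Longrightarrow> measure (walk_law w z) A \<le> s"
    and wy: "(w, y) \<in> D"
  shows "measure (walk_law w y) (A \<inter> hit z) \<le> s * measure (walk_law w y) (hit z)"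
proof -
  have "measure (walk_law w y) (A \<inter> hit_by z k) \<le> s * measure (walk_law w y) (hit_by z k)" for k
    using wy
  proof (induction k arbitrary: w y)
    case 0
    show ?case
    proof (cases "y = z")
      case True
      have "measure (walk_law w z) (A \<inter> hit_by z 0) \<le> measure (walk_law w z) A"
        using A by (intro walk_law_mono) auto
      with s(2)[of w] 0 True show ?thesis by (simp add: hit_by_self)
    next
      case False
      have "measure (walk_law w y) (A \<inter> hit_by z 0) \<le> measure (walk_law w y) (hit_by z 0)"
        by (intro walk_law_mono sets_hit_by) auto
      with hit_by_0[OF False, of w] show ?thesis by simp
    qed
  next
    case (Suc k)
    note e = cookie_envD[OF D[OF Suc.prems], of y]
    show ?case
    proof (cases "y = z")
      case True
      have "measure (walk_law w z) (A \<inter> hit_by z (Suc k)) \<le> measure (walk_law w z) A"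
        using A by (intro walk_law_mono) auto
      with s(2)[of w] Suc.prems True show ?thesis by (simp add: hit_by_self)
    next
      case False
      let ?B = "{X. case_nat y X \<in> A \<inter> hit_by z (Suc k)}"
      have sub: "?B \<subseteq> A \<inter> hit_by z k"
      proof
        fix X assume X: "X \<in> ?B"
        then obtain j where j: "j \<le> Suc k" "case_nat y X j = z" by (auto simp: hit_by_def)
        with False have "X \<in> hit_by z k" by (cases j) (auto simp: hit_by_def)
        with X A(2)[of y X] show "X \<in> A \<inter> hit_by z k" by simp
      qed
      have m: "measure (walk_law v x) ?B \<le> measure (walk_law v x) (A \<inter> hit_by z k)" for v x
        using sub A by (intro walk_law_mono) auto
      have "measure (walk_law w y) (A \<inter> hit_by z (Suc k)) = w y * measure (walk_law w (y + 1)) ?B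
          + (1 - w y) * measure (walk_law (w(y := 1 / 2)) (y - 1)) ?B"
        using A by (intro walk_first_step D[OF Suc.prems]) auto
      also have "\<dots> \<le> w y * (s * measure (walk_law w (y + 1)) (hit_by z k))
          + (1 - w y) * (s * measure (walk_law (w(y := 1 / 2)) (y - 1)) (hit_by z k))"
        using e closed[OF Suc.prems False]
        by (intro add_mono mult_left_mono order_trans[OF m Suc.IH]) (auto simp del: fun_upd_apply)
      also have "\<dots> = s * measure (walk_law w y) (hit_by z (Suc k))"
        unfolding hit_by_step[OF D[OF Suc.prems] False, of k] by (simp only: ring_distribs mult.left_commute)
      finally show ?thesis .
    qed
  qed
  then show ?thesis
    using hit_by_tendsto[OF UNIV_paths, of w y z]
    by (intro LIMSEQ_le[OF hit_by_tendsto[OF A(1)] tendsto_mult_left]) auto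
qed

section \<open>Recurrence and transience\<close>

lemma translate_Suc: "translate (b + 1) w = shift (translate b w)"
  by (simp add: translate_def shift_def fun_eq_iff add_ac)

lemma funpow_shift: "(shift ^^ n) w = translate (int n) w"
proof (induction n)
  case (Suc n)
  then show ?case using translate_Suc[of "int n" w] by (simp add: add.commute)
qed (simp add: translate_def)

lemma escape_translate_0_iff:
  assumes "cookie_env w"
  shows "escape (translate b w) 0 = 0 \<longleftrightarrow> escape w 0 = 0"
proof (induction b rule: int_induct[where k = 0])
  case base
  show ?case by (simp add: translate_def)
next
  case (step1 i)
  then show ?case using escape_shift_0_iff[of "translate i w"] assms by (simp add: translate_Suc)
next
  case (step2 i)
  then show ?case using escape_shift_0_iff[of "translate (i - 1) w"] translate_Suc[of "i - 1" w] assms by simp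
qed

text \<open>Whether \<open>escape\<close> vanishes can be read off to the right of \<open>y\<close>,
  where both environments coincide.\<close>

lemma escape_upd_0_iff:
  assumes "cookie_env w"
  shows "escape (w(y := 1 / 2)) 0 = 0 \<longleftrightarrow> escape w 0 = 0"
proof -
  have "escape (translate (y + 1) (w(y := 1 / 2))) = escape (translate (y + 1) w)"
    by (rule escape_cong) (simp add: translate_def)
  then show ?thesis
    using escape_translate_0_iff[OF assms, of "y + 1"]
      escape_translate_0_iff[OF cookie_env_upd[OF assms], of "y + 1" y] by metis
qed

lemma walk_law_le_hit:
  assumes "measure (walk_law w y) (hit z) = 1" "A \<in> sets paths"
  shows "measure (walk_law w y) A \<le> measure (walk_law w y) (A \<inter> hit z)"
proof -
  have "measure (walk_law w y) A \<le> measure (walk_law w y) ((A \<inter> hit z) \<union> - hit z)"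
    using assms(2) by (intro walk_law_mono sets.Un sets.Int Compl_in_sets_paths sets_hit) auto
  also have "\<dots> \<le> measure (walk_law w y) (A \<inter> hit z) + measure (walk_law w y) (- hit z)"
    using assms(2) by (intro measure_Un_le) (auto simp: sets_walk_law intro!: sets.Int Compl_in_sets_paths)
  finally show ?thesis using assms(1) by (simp add: walk_law_compl)
qed

text \<open>A target on the left is approached one site at a time. Each passage alters the
  environment at random, but within the class of vanishing \<open>escape\<close>, on which the
  induction hypothesis is uniform.\<close>

lemma recurrent_hit:
  assumes "cookie_env w" "escape w 0 = 0"
  shows "measure (walk_law w y) (hit x) = 1"
proof (cases "y \<le> x")
  case True
  with assms show ?thesis by (intro hit_right)
next
  case False
  have "measure (walk_law w (x + int j)) (hit x) = 1" if "cookie_env w" "escape w 0 = 0" for j w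
    using that
  proof (induction j arbitrary: w)
    case 0
    show ?case by (simp add: hit_self)
  next
    case (Suc j)
    let ?y = "x + int (Suc j)" and ?z = "x + int j"
    let ?D = "{(w, y :: int). cookie_env w \<and> escape w 0 = 0}"
    have "1 - escape (translate ?y w) 0 \<le> measure (walk_law w ?y) (hit (?y - 1))"
      by (rule hit_left_ge[OF Suc.prems(1)])
    moreover have "escape (translate ?y w) 0 = 0"
      using escape_translate_0_iff[OF Suc.prems(1)] Suc.prems(2) by simp
    ultimately have z: "measure (walk_law w ?y) (hit ?z) = 1" by (simp add: antisym)
    have A: "- hit x \<in> sets paths" by (intro Compl_in_sets_paths sets_hit)
    have "measure (walk_law w ?y) (- hit x \<inter> hit ?z) \<le> 0 * measure (walk_law w ?y) (hit ?z)"
    proof (rule strong_markov_le[where D = ?D])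
      show "X \<in> - hit x" if "case_nat y X \<in> - hit x" for y X
      proof
        assume "X \<in> hit x"
        then obtain j where "case_nat y X (Suc j) = x" by (auto simp: hit_def)
        with that show False unfolding hit_def by blast
      qed
      show "measure (walk_law w ?z) (- hit x) \<le> 0" if "(w, ?z) \<in> ?D" for w
        using Suc.IH[of w] that by (simp add: walk_law_compl)
      show "(w, y + 1) \<in> ?D \<and> (w(y := 1 / 2), y - 1) \<in> ?D" if "(w, y) \<in> ?D" for w y
        using that escape_upd_0_iff[of w y] by (simp del: fun_upd_apply)
    qed (use A Suc.prems in auto)
    with walk_law_le_hit[OF z A] have "1 - measure (walk_law w ?y) (hit x) \<le> 0"
      by (simp only: walk_law_compl[OF sets_hit] mult_zero_left)
    then show ?case by (simp add: antisym)
  qed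
  from this[of w "nat (y - x)"] assms False show ?thesis by simp
qed

lemma sets_io [measurable]: "{X. \<exists>\<^sub>\<infinity>n. X n = x} \<in> sets paths"
  using sets_infinitely_often[of x] by (simp add: sets_walk_law)

text \<open>Avoiding \<open>x\<close> from time \<open>m\<close> on is null for all admissible
  environments and starts at once: deleting the first step passes from \<open>Suc m\<close> to
  \<open>m\<close>, and \<open>m = 0\<close> is the hitting statement.\<close>

lemma recurrent_envI:
  assumes "cookie_env w" "escape w 0 = 0"
  shows "recurrent_env w"
  unfolding recurrent_env_def
proof (intro allI)
  fix x y
  define N where "N m = {X :: nat \<Rightarrow> int. \<forall>n\<ge>m. X n \<noteq> x}" for m
  have N: "N m \<in> sets paths" for m
  proof -
    have "{X \<in> space paths. \<forall>n\<ge>m. X n \<noteq> x} \<in> sets paths" by measurable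
    then show ?thesis by (simp add: N_def)
  qed
  have null: "measure (walk_law w y) (N m) = 0" if "cookie_env w" "escape w 0 = 0" for m w y
    using that
  proof (induction m arbitrary: w y)
    case 0
    have "N 0 = - hit x" by (auto simp: N_def hit_def)
    with recurrent_hit[OF 0] show ?case by (simp add: walk_law_compl)
  next
    case (Suc m)
    have "{X. case_nat y X \<in> N (Suc m)} = N m"
    proof (intro set_eqI iffI)
      fix X assume "X \<in> {X. case_nat y X \<in> N (Suc m)}"
      then have "case_nat y X (Suc n) \<noteq> x" if "n \<ge> m" for n
        unfolding N_def using that Suc_le_mono by blast
      then show "X \<in> N m" by (simp add: N_def)
    next
      fix X assume "X \<in> N m"
      then have "case_nat y X n \<noteq> x" if "n \<ge> Suc m" for n
        using that by (cases n) (auto simp: N_def)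
      then show "X \<in> {X. case_nat y X \<in> N (Suc m)}" by (simp add: N_def)
    qed
    with walk_first_step[OF Suc.prems(1) N, of y "Suc m"]
      Suc.IH[OF Suc.prems] Suc.IH[of "w(y := 1 / 2)" "y - 1"] Suc.prems escape_upd_0_iff[of w y]
    show ?case by (simp del: fun_upd_apply)
  qed
  have "(\<lambda>m. measure (walk_law w y) (N m)) \<longlonglongrightarrow> measure (walk_law w y) (\<Union>m. N m)"
    using N by (intro finite_measure.finite_Lim_measure_incseq
        prob_space.finite_measure[OF prob_space_walk_law] incseq_SucI)
      (auto simp: sets_walk_law N_def dest: Suc_leD)
  then have "measure (walk_law w y) (\<Union>m. N m) = 0"
    using null[OF assms] by (simp add: LIMSEQ_const_iff)
  moreover have "{X. \<exists>\<^sub>\<infinity>n. X n = x} = - (\<Union>m. N m)" by (auto simp: N_def INFM_nat_le)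
  moreover have "(\<Union>m. N m) \<in> sets paths" using N by auto
  ultimately show "measure (walk_law w y) {X. \<exists>\<^sub>\<infinity>n. X n = x} = 1"
    by (simp only: walk_law_compl)
qed

text \<open>A bound \<open>s\<close> on the probability of infinitely many visits that is uniform over all
  positions and all local modifications of the environment improves to \<open>s * (1 - c)\<close>: the
  walk first reaches an unvisited site from which it escapes with probability at least \<open>c\<close>.\<close>

lemma transient_envI:
  assumes w0: "cookie_env w0" and c: "c > 0"
    and io: "\<forall>m. \<exists>n\<ge>m. c \<le> escape (translate (int n) w0) 0"
  shows "transient_env w0"
  unfolding transient_env_def
proof (intro allI)
  fix x y
  define A where "A = {X :: nat \<Rightarrow> int. \<exists>\<^sub>\<infinity>n. X n = x}"
  have A: "A \<in> sets paths" unfolding A_def by (rule sets_io)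
  have A_cons: "X \<in> A" if "case_nat y X \<in> A" for y X
    unfolding A_def mem_Collect_eq INFM_nat_le
  proof
    fix m
    from that obtain n where n: "n \<ge> Suc m" "case_nat y X n = x" by (auto simp: A_def INFM_nat_le)
    then obtain n' where "n = Suc n'" by (cases n) auto
    with n show "\<exists>n\<ge>m. X n = x" by auto
  qed
  have A_hit: "A \<subseteq> hit x" by (auto simp: A_def hit_def INFM_nat_le)
  have c1: "c \<le> 1"
    using io escape_bounds[OF cookie_env_translate[OF w0]] order_trans by meson
  \<comment> \<open>This covers every environment the walk can produce: changes to \<open>w0\<close>
    are confined to sites left of \<open>n\<close>.\<close>
  let ?E = "\<lambda>n w. cookie_env w \<and> (\<forall>u\<ge>n. w u = w0 u)"
  have bound: "measure (walk_law w y) A \<le> (1 - c) ^ k" if "?E z w" for k z w y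
    using that
  proof (induction k arbitrary: z w y)
    case (Suc k)
    \<comment> \<open>\<open>n\<close> is at or beyond \<open>z\<close>, so the environment from
      \<open>n\<close> on is unchanged; at or beyond \<open>y\<close>, so it is reached almost
      surely; and beyond \<open>x\<close>, so a visit to \<open>x\<close> means a failure to
      escape.\<close>
    obtain n :: nat where n: "n \<ge> nat (max z (max y (x + 1)))" "c \<le> escape (translate (int n) w0) 0"
      using io by blast
    let ?n = "int n"
    have n': "z \<le> ?n" "y \<le> ?n" "x < ?n" using n(1) by auto
    have start: "measure (walk_law v ?n) A \<le> (1 - c) ^ Suc k" if v: "?E ?n v" for v
    proof -
      let ?D = "{(w, y :: int). \<exists>z. ?E z w}"
      have "measure (walk_law v ?n) (A \<inter> hit x) \<le> (1 - c) ^ k * measure (walk_law v ?n) (hit x)"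
      proof (rule strong_markov_le[where D = ?D])
        show "(w, y + 1) \<in> ?D \<and> (w(y := 1 / 2), y - 1) \<in> ?D" if D: "(w, y) \<in> ?D" for w y
        proof -
          from D obtain z where "?E z w" by auto
          then have "?E (max z (y + 1)) (w(y := 1 / 2))" by auto
          with D show ?thesis by blast
        qed
      qed (use A A_cons c1 Suc.IH v in auto)
      moreover have "A \<inter> hit x = A" using A_hit by auto
      moreover have "measure (walk_law v ?n) (hit x) \<le> 1 - escape (translate ?n v) 0"
        using v n' by (intro hit_left_le) auto
      moreover have "escape (translate ?n v) = escape (translate ?n w0)"
        using v by (intro escape_cong) (simp add: translate_def)
      ultimately have "measure (walk_law v ?n) A \<le> (1 - c) ^ k * measure (walk_law v ?n) (hit x)"
        and "measure (walk_law v ?n) (hit x) \<le> 1 - c"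
        using n(2) by simp_all
      note this(1)
      also have "(1 - c) ^ k * measure (walk_law v ?n) (hit x) \<le> (1 - c) ^ k * (1 - c)"
        using \<open>measure (walk_law v ?n) (hit x) \<le> 1 - c\<close> c1 by (intro mult_left_mono) auto
      finally show ?thesis by (simp add: mult.commute)
    qed
    \<comment> \<open>Positions stay at most \<open>?n\<close> until \<open>?n\<close> is hit, so
      earlier left jumps change only sites left of \<open>?n\<close>, and \<open>start\<close>
      applies at the first visit.\<close>
    let ?D = "{(w, y). ?E ?n w \<and> y \<le> ?n}"
    have "measure (walk_law w y) (A \<inter> hit ?n) \<le> (1 - c) ^ Suc k * measure (walk_law w y) (hit ?n)"
    proof (rule strong_markov_le[where D = ?D])
      show "(w, y + 1) \<in> ?D \<and> (w(y := 1 / 2), y - 1) \<in> ?D" if "(w, y) \<in> ?D" "y \<noteq> ?n" for w y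
        using that by auto
    qed (use A A_cons c1 start Suc.prems n' in auto)
    moreover have "measure (walk_law w y) (hit ?n) = 1"
      using Suc.prems n' by (intro hit_right) auto
    ultimately show ?case using walk_law_le_hit[OF _ A, of w y ?n] by simp
  qed simp
  have "(\<lambda>k. (1 - c) ^ k) \<longlonglongrightarrow> 0" using c c1 by (intro LIMSEQ_realpow_zero) auto
  then have "measure (walk_law w0 y) A \<le> 0"
    by (rule LIMSEQ_le_const) (use bound[where z = 0 and w = w0] w0 in auto)
  then show "measure (walk_law w0 y) {X. \<exists>\<^sub>\<infinity>n. X n = x} = 0" by (simp add: A_def antisym)
qed

theorem theorem2:
  fixes P :: "(int \<Rightarrow> real) measure"
  assumes "stationary_law P"
    and "ergodic_law P"
    and "AE \<omega> in P. \<forall>x. 1 / 2 \<le> \<omega> x \<and> \<omega> x < 1"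
  shows "((\<integral>\<^sup>+ \<omega>. ennreal (\<omega> 0 / (1 - \<omega> 0)) \<partial>P) \<le> 2 \<longrightarrow> (AE \<omega> in P. recurrent_env \<omega>)) \<and>
         ((\<integral>\<^sup>+ \<omega>. ennreal (\<omega> 0 / (1 - \<omega> 0)) \<partial>P) > 2 \<longrightarrow> (AE \<omega> in P. transient_env \<omega>))"
proof -
  interpret stationary_cookie_law P
    using assms(1,3)
    by (auto simp: stationary_cookie_law_def stationary_cookie_law_axioms_def stationary_law_def cookie_env_def)
  show ?thesis
    using escape_dichotomy[OF assms(2)]
  proof
    assume rec: "AE w in P. escape w 0 = 0"
    have "AE w in P. recurrent_env w"
      using cookie rec by eventually_elim (rule recurrent_envI)
    \<comment> \<open>In this alternative the mean is at most 2, so the second implication has a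
      false premise; the other alternative is dual.\<close>
    with recurrent_imp_le_2[OF rec] show ?thesis by simp
  next
    assume trans: "AE w in P. escape w 0 \<noteq> 0"
    obtain c where c: "c > 0" "AE w in P. \<forall>m. \<exists>n\<ge>m. c \<le> escape ((shift ^^ n) w) 0"
      using escape_infinitely_often[OF assms(2) trans] by blast
    from cookie c(2) have "AE w in P. transient_env w"
      by eventually_elim (use c(1) in \<open>auto simp: funpow_shift intro: transient_envI\<close>)
    with transient_imp_gt_2[OF trans] show ?thesis by simp
  qed
qed

end
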